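(* Let $A\in\mathbb{H}^{n\times n}$ with $\operatorname{rk}A=s$, $\operatorname{Ind}A=m$, and $\operatorname{rk}(A^{m})=s_1\ge1$. Then the CMP inverse $X=(x_{ij})$ of $A$ has, for all $i,j\in\{1,\dots,n\}$, the following determinantal representations. (i) If $A$ is arbitrary, then for each $l\in\{1,2\}$ $$x_{ij}=\frac{\sum_{\beta\in J_{s,n}\{i\}}\operatorname{cdet}_{i}\left((A^{*}A)_{.i}(v^{(l)}_{.j})\right)_{\beta}^{\beta}}{\left(\sum_{\beta\in J_{s,n}}\left|A^{*}A\right|_{\beta}^{\beta}\right)^{2}\sum_{\beta\in J_{s_1,n}}\left|(A^{2m+1})^{*}A^{2m+1}\right|_{\beta}^{\beta}}=\frac{\sum_{\alpha\in I_{s,n}\{j\}}\operatorname{rdet}_{j}\left((AA^{*})_{j.}(w^{(l)}_{i.})\right)_{\alpha}^{\alpha}}{\left(\sum_{\alpha\in I_{s,n}}\left|AA^{*}\right|_{\alpha}^{\alpha}\right)^{2}\sum_{\beta\in J_{s_1,n}}\left|(A^{2m+1})^{*}A^{2m+1}\right|_{\beta}^{\beta}},$$ where $$v^{(1)}_{.j}=\Big[\sum_{\alpha\in I_{s,n}\{j\}}\operatorname{rdet}_{j}\left((AA^{*})_{j.}(\hat u_{t.})\right)_{\alpha}^{\alpha}\Big]_{t=1,\dots,n}\in\mathbb{H}^{n\times1},\quad w^{(1)}_{i.}=\Big[\sum_{\beta\in J_{s,n}\{i\}}\operatorname{cdet}_{i}\left((A^{*}A)_{.i}(\hat u_{.k})\right)_{\beta}^{\beta}\Big]_{k=1,\dots,n}\in\mathbb{H}^{1\times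 n},$$ $$v^{(2)}_{.j}=\Big[\sum_{\alpha\in I_{s,n}\{j\}}\operatorname{rdet}_{j}\left((AA^{*})_{j.}(\hat g_{t.})\right)_{\alpha}^{\alpha}\Big]_{t=1,\dots,n}\in\mathbb{H}^{n\times1},\quad w^{(2)}_{i.}=\Big[\sum_{\beta\in J_{s,n}\{i\}}\operatorname{cdet}_{i}\left((A^{*}A)_{.i}(\hat g_{.k})\right)_{\beta}^{\beta}\Big]_{k=1,\dots,n}\in\mathbb{H}^{1\times n}.$$ Here $\hat u_{t.}$ and $\hat u_{.k}$ are the $t$th row and $k$th column of $\hat U:=UA^{m+1}A^{*}$, $\hat g_{t.}$ and $\hat g_{.k}$ are the $t$th row and $k$th column of $\hat G:=A^{*}A^{2}G$, and $U=(u_{ij})$, $G=(g_{ij})\in\mathbb{H}^{n\times n}$ are given by $$u_{ij}=\sum_{\alpha\in I_{s_1,n}\{j\}}\operatorname{rdet}_{j}\left(\left(A^{2m+1}(A^{2m+1})^{*}\right)_{j.}(a^{(1)}_{i.})\right)_{\alpha}^{\alpha},\qquad g_{ij}=\sum_{\beta\in J_{s_1,n}\{i\}}\operatorname{cdet}_{i}\left(\left((A^{2m+1})^{*}A^{2m+1}\right)_{.i}(a^{(2)}_{.j})\right)_{\beta}^{\beta},$$ where $a^{(1)}_{i.}$ is the $i$th row of $A^{*}A^{m+1}(A^{2m+1})^{*}$ and $a^{(2)}_{.j}$ is the $j$th column of $(A^{2m+1})^{*}A^{m+1}A^{*}$. (ii) If $A$ is Hermitian, then for each $l\in\{1,2\}$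 $$x_{ij}=\frac{\sum_{\beta\in J_{s,n}\{i\}}\operatorname{cdet}_{i}\left((A^{2})_{.i}(v^{(l)}_{.j})\right)_{\beta}^{\beta}}{\left(\sum_{\beta\in J_{s,n}}\left|A^{2}\right|_{\beta}^{\beta}\right)^{2}\sum_{\beta\in J_{s_1,n}}\left|A^{m+1}\right|_{\beta}^{\beta}}=\frac{\sum_{\alpha\in I_{s,n}\{j\}}\operatorname{rdet}_{j}\left((A^{2})_{j.}(w^{(l)}_{i.})\right)_{\alpha}^{\alpha}}{\left(\sum_{\alpha\in I_{s,n}}\left|A^{2}\right|_{\alpha}^{\alpha}\right)^{2}\sum_{\beta\in J_{s_1,n}}\left|A^{m+1}\right|_{\beta}^{\beta}},$$ where (with new meanings of the symbols $v^{(l)},w^{(l)},U,\hat U,G,\hat G$) $$v^{(1)}_{.j}=\Big[\sum_{\alpha\in I_{s,n}\{j\}}\operatorname{rdet}_{j}\left((A^{2})_{j.}(\hat u_{t.})\right)_{\alpha}^{\alpha}\Big]_{t=1,\dots,n}\in\mathbb{H}^{n\times1},\quad w^{(1)}_{i.}=\Big[\sum_{\beta\in J_{s,n}\{i\}}\operatorname{cdet}_{i}\left((A^{2})_{.i}(\hat u_{.k})\right)_{\beta}^{\beta}\Big]_{k=1,\dots,n}\in\mathbb{H}^{1\times n},$$ $$v^{(2)}_{.j}=\Big[\sum_{\alpha\in I_{s,n}\{j\}}\operatorname{rdet}_{j}\left((A^{2})_{j.}(\hat g_{t.})\right)_{\alpha}^{\alpha}\Big]_{t=1,\dots,n}\in\mathbb{H}^{n\times1},\quad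 w^{(2)}_{i.}=\Big[\sum_{\beta\in J_{s,n}\{i\}}\operatorname{cdet}_{i}\left((A^{2})_{.i}(\hat g_{.k})\right)_{\beta}^{\beta}\Big]_{k=1,\dots,n}\in\mathbb{H}^{1\times n}.$$ Here $\hat u_{t.}$ and $\hat u_{.k}$ are the $t$th row and $k$th column of $\hat U:=UA^{2}$, $\hat g_{t.}$ and $\hat g_{.k}$ are the $t$th row and $k$th column of $\hat G:=A^{2}G$, and $U=(u_{ij})$, $G=(g_{ij})\in\mathbb{H}^{n\times n}$ are given by $$u_{ij}=\sum_{\alpha\in I_{s_1,n}\{j\}}\operatorname{rdet}_{j}\left((A^{m+1})_{j.}(a^{(m+2)}_{i.})\right)_{\alpha}^{\alpha},\qquad g_{ij}=\sum_{\beta\in J_{s_1,n}\{i\}}\operatorname{cdet}_{i}\left((A^{m+1})_{.i}(a^{(m+2)}_{.j})\right)_{\beta}^{\beta},$$ where $a^{(m+2)}_{i.}$ and $a^{(m+2)}_{.j}$ are the $i$th row and the $j$th column of $A^{m+2}$.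
   Context: $\mathbb{H}$ is the skew field of real quaternions, $A^{*}$ is the conjugate transpose, $A$ is Hermitian if $A^*=A$, and $\operatorname{rk}A$ is the rank of $A$ (dimension of the right column space, equal to the dimension of the left row space). $\operatorname{Ind}A$ is the smallest nonnegative integer $k$ with $\operatorname{rk}A^{k+1}=\operatorname{rk}A^{k}$ (with $A^0$ the identity; $\operatorname{Ind}A=0$ iff $A$ is nonsingular). The Moore-Penrose inverse $A^{\dagger}$ is the unique $X$ with $AXA=A$, $XAX=X$, $(AX)^{*}=AX$, $(XA)^{*}=XA$. The Drazin inverse $A^{d}$ is the unique $X$ with $XAX=X$, $AX=XA$, $XA^{k+1}=A^{k}$, $k=\operatorname{Ind}A$. The CMP inverse of $A$ is the matrix $(A^{\dagger}A)A^{d}(AA^{\dagger})$; equivalently it is $A^{\dagger}A_1A^{\dagger}$, where $A_1=AA^{d}A$ is the core part in the core-nilpotent decomposition $A=A_1+A_2$ ($A_2$ nilpotent, $A_1A_2=A_2A_1=0$). Row and column determinants: let $M=(m_{pq})$ be a square quaternion matrix of size $N$ whose rows and columns are both labelled by a set $\alpha$ of $N$ integers, and let $i,j\in\alpha$. Then $$\operatorname{rdet}_iM=\sum_{\sigma}(-1)^{N-r}\left(m_{i\,i_{k_1}}m_{i_{k_1}i_{k_1+1}}\cdots m_{i_{k_1+l_1}i}\right)\cdots\left(m_{i_{k_r}i_{k_r+1}}\cdots m_{i_{k_r+l_r}i_{k_r}}\right),$$ the sum over all permutations $\sigma$ of $\alpha$, each written as a product of its $r$ disjoint cycles (fixed points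 included) $\sigma=(i\,i_{k_1}\dots i_{k_1+l_1})(i_{k_2}\dots i_{k_2+l_2})\cdots(i_{k_r}\dots i_{k_r+l_r})$, where the first cycle starts with $i$, every other cycle starts with its smallest element, and $i_{k_2}<\dots<i_{k_r}$; and $$\operatorname{cdet}_jM=\sum_{\tau}(-1)^{N-r}\left(m_{j_{k_r}j_{k_r+l_r}}\cdots m_{j_{k_r+1}j_{k_r}}\right)\cdots\left(m_{j\,j_{k_1+l_1}}\cdots m_{j_{k_1+1}j_{k_1}}m_{j_{k_1}j}\right),$$ the sum over all permutations $\tau=(j_{k_r+l_r}\dots j_{k_r+1}j_{k_r})\cdots(j_{k_2+l_2}\dots j_{k_2})(j_{k_1+l_1}\dots j_{k_1}j)$ of $\alpha$, where the rightmost cycle ends with $j$, every other cycle has its smallest element rightmost, and $j_{k_2}<\dots<j_{k_r}$. A fixed point $p$ contributes the factor $m_{pp}$. If $M$ is Hermitian, all $\operatorname{rdet}_iM$ and $\operatorname{cdet}_jM$ coincide and are real; the common value is $\det M$. Index sets and submatrices: for $1\le k\le n$, $I_{k,n}=J_{k,n}$ is the set of all $k$-element subsets of $\{1,\dots,n\}$, and $I_{k,n}\{j\}=J_{k,n}\{j\}$ is the collection of those containing $j$. $M_\alpha^\alpha$ is the principal submatrix with rows and columns indexed by $\alpha$ (labels kept); for Hermitian $M$, $|M|_\alpha^\alpha=\det(M_\alpha^\alpha)$. $M_{j.}(b)$ (resp. $M_{.i}(c)$) is $M$ with its $j$th row replaced by the row $b$ (resp. $i$th column replaced by the column $c$). $\operatorname{rdet}_j(M_{j.}(b))_\alpha^\alpha$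 means $\operatorname{rdet}_j$ (along the row labelled $j$) of the principal submatrix $(M_{j.}(b))_\alpha^\alpha$; similarly $\operatorname{cdet}_i(M_{.i}(c))_\beta^\beta$.
   Formalization: In part (i) the matrix Ĝ is taken as A*A^{m+1}G instead of the printed A*A²G, which agrees for m=1 but is false in general (n=1, A=2, m=0 would give 1 instead of the CMP inverse 1/2). *)

theory Defs
  imports "HOL-Analysis.Analysis" "HOL-Combinatorics.Combinatorics"
begin

section \<open>The skew field of real quaternions\<close>

datatype quat = Quat (qre: real) (qim_i: real) (qim_j: real) (qim_k: real)

lemma quat_eq_iff:
  "x = y \<longleftrightarrow> qre x = qre y \<and> qim_i x = qim_i y \<and> qim_j x = qim_j y \<and> qim_k x = qim_k y"
  by (cases x; cases y) auto

definition qnorm2 :: "quat \<Rightarrow> real" where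
  "qnorm2 x = (qre x)\<^sup>2 + (qim_i x)\<^sup>2 + (qim_j x)\<^sup>2 + (qim_k x)\<^sup>2"

definition qcnj :: "quat \<Rightarrow> quat" where
  "qcnj x = Quat (qre x) (- qim_i x) (- qim_j x) (- qim_k x)"

lemma qcnj_sel [simp]:
  "qre (qcnj x) = qre x" "qim_i (qcnj x) = - qim_i x"
  "qim_j (qcnj x) = - qim_j x" "qim_k (qcnj x) = - qim_k x"
  by (simp_all add: qcnj_def)

instantiation quat :: ab_group_add
begin

definition "0 = Quat 0 0 0 0"
definition "x + y = Quat (qre x + qre y) (qim_i x + qim_i y) (qim_j x + qim_j y) (qim_k x + qim_k y)"
definition "- x = Quat (- qre x) (- qim_i x) (- qim_j x) (- qim_k x)"
definition "x - y = Quat (qre x - qre y) (qim_i x - qim_i y) (qim_j x - qim_j y) (qim_k x - qim_k y)"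

instance
  by standard
    (simp_all add: quat_eq_iff zero_quat_def plus_quat_def uminus_quat_def minus_quat_def)

end

lemma quat_add_sel [simp]:
  "qre 0 = 0" "qim_i 0 = 0" "qim_j 0 = 0" "qim_k 0 = 0"
  "qre (x + y) = qre x + qre y" "qim_i (x + y) = qim_i x + qim_i y"
  "qim_j (x + y) = qim_j x + qim_j y" "qim_k (x + y) = qim_k x + qim_k y"
  "qre (- x) = - qre x" "qim_i (- x) = - qim_i x"
  "qim_j (- x) = - qim_j x" "qim_k (- x) = - qim_k x"
  "qre (x - y) = qre x - qre y" "qim_i (x - y) = qim_i x - qim_i y"
  "qim_j (x - y) = qim_j x - qim_j y" "qim_k (x - y) = qim_k x - qim_k y"
  by (simp_all add: zero_quat_def plus_quat_def uminus_quat_def minus_quat_def)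

lemma qnorm2_eq_0_iff: "qnorm2 x = 0 \<longleftrightarrow> x = 0"
  by (simp add: qnorm2_def quat_eq_iff add_nonneg_eq_0_iff)

instantiation quat :: real_div_algebra
begin

definition "1 = Quat 1 0 0 0"
definition "x * y = Quat
  (qre x * qre y - qim_i x * qim_i y - qim_j x * qim_j y - qim_k x * qim_k y)
  (qre x * qim_i y + qim_i x * qre y + qim_j x * qim_k y - qim_k x * qim_j y)
  (qre x * qim_j y - qim_i x * qim_k y + qim_j x * qre y + qim_k x * qim_i y)
  (qre x * qim_k y + qim_i x * qim_j y - qim_j x * qim_i y + qim_k x * qre y)"
definition "r *\<^sub>R x = Quat (r * qre x) (r * qim_i x) (r * qim_j x) (r * qim_k x)"
definition "inverse x = inverse (qnorm2 x) *\<^sub>R qcnj x"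
definition "x div y = x * inverse (y :: quat)"

lemma quat_mult_sel:
  "qre (x * y) = qre x * qre y - qim_i x * qim_i y - qim_j x * qim_j y - qim_k x * qim_k y"
  "qim_i (x * y) = qre x * qim_i y + qim_i x * qre y + qim_j x * qim_k y - qim_k x * qim_j y"
  "qim_j (x * y) = qre x * qim_j y - qim_i x * qim_k y + qim_j x * qre y + qim_k x * qim_i y"
  "qim_k (x * y) = qre x * qim_k y + qim_i x * qim_j y - qim_j x * qim_i y + qim_k x * qre y"
  by (simp_all add: times_quat_def)

lemma quat_scaleR_sel [simp]:
  "qre (r *\<^sub>R x) = r * qre x" "qim_i (r *\<^sub>R x) = r * qim_i x"
  "qim_j (r *\<^sub>R x) = r * qim_j x" "qim_k (r *\<^sub>R x) = r * qim_k x"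
  by (simp_all add: scaleR_quat_def)

lemma quat_one_sel [simp]:
  "qre 1 = 1" "qim_i 1 = 0" "qim_j 1 = 0" "qim_k 1 = 0"
  by (simp_all add: one_quat_def)

instance
proof
  fix x :: quat
  assume "x \<noteq> 0"
  then have nz: "qnorm2 x \<noteq> 0"
    by (simp add: qnorm2_eq_0_iff)
  have "qcnj x * x = qnorm2 x *\<^sub>R 1" and "x * qcnj x = qnorm2 x *\<^sub>R 1"
    by (simp_all add: quat_eq_iff quat_mult_sel qnorm2_def power2_eq_square)
  moreover have "(r *\<^sub>R y) * z = r *\<^sub>R (y * z)" "y * (r *\<^sub>R z) = r *\<^sub>R (y * z)" for r and y z :: quat
    by (simp_all add: quat_eq_iff quat_mult_sel algebra_simps)
  moreover have "r *\<^sub>R s *\<^sub>R (1::quat) = (r * s) *\<^sub>R 1" for r s :: real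
    by (simp add: quat_eq_iff)
  ultimately show "inverse x * x = 1" and "x * inverse x = 1"
    using nz by (simp_all add: inverse_quat_def) (simp_all add: quat_eq_iff)
qed (simp_all add: quat_eq_iff quat_mult_sel algebra_simps divide_quat_def,
     simp_all add: inverse_quat_def quat_eq_iff)

end

section \<open>Quaternion matrices\<close>

type_synonym 'n qvec = "(quat, 'n) vec"
type_synonym 'n qmat = "((quat, 'n) vec, 'n) vec"

definition adj :: "quat^'n^'m \<Rightarrow> quat^'m^'n"  ("_\<^sup>H" [1000] 999) where
  "A\<^sup>H = (\<chi> i j. qcnj (A $ j $ i))"

definition hermitian :: "'n::finite qmat \<Rightarrow> bool" where
  "hermitian A \<longleftrightarrow> A\<^sup>H = A"

primrec mpow :: "'n::finite qmat \<Rightarrow> nat \<Rightarrow> 'n qmat"  (infixr "^^^" 80) where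
  "A ^^^ 0 = mat 1"
| "A ^^^ (Suc k) = A ** (A ^^^ k)"

text \<open>
  The library's linear algebra (span, dimension, rank) needs a commutative field of scalars.
  The following is the right vector space structure on quaternion vectors; the shape of
  \<open>rdim\<close> is that of \<^const>\<open>vector_space.dim\<close>.
\<close>

definition rscale :: "quat^'n \<Rightarrow> quat \<Rightarrow> quat^'n"  (infixl "*\<^sub>r" 75) where
  "v *\<^sub>r c = (\<chi> i. v $ i * c)"

definition rspan :: "(quat^'n) set \<Rightarrow> (quat^'n) set" where
  "rspan S = {\<Sum>v\<in>T. v *\<^sub>r c v | T c. finite T \<and> T \<subseteq> S}"

definition rindependent :: "(quat^'n) set \<Rightarrow> bool" where
  "rindependent S \<longleftrightarrow>
     (\<forall>T c. finite T \<longrightarrow> T \<subseteq> S \<longrightarrow> (\<Sum>v\<in>T. v *\<^sub>r c v) = 0 \<longrightarrow> (\<forall>v\<in>T. c v = 0))"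

definition rdim :: "(quat^'n) set \<Rightarrow> nat" where
  "rdim V = card (SOME B. rindependent B \<and> rspan B = V)"

definition rk :: "quat^'n^'m \<Rightarrow> nat" where
  "rk A = rdim (rspan (columns A))"

definition Ind :: "'n::finite qmat \<Rightarrow> nat" where
  "Ind A = (LEAST k. rk (A ^^^ (k + 1)) = rk (A ^^^ k))"

definition MP_inverse :: "'n::finite qmat \<Rightarrow> 'n qmat"  ("_\<^sup>\<dagger>" [1000] 999) where
  "A\<^sup>\<dagger> = (THE X. A ** X ** A = A \<and> X ** A ** X = X \<and> (A ** X)\<^sup>H = A ** X \<and> (X ** A)\<^sup>H = X ** A)"

definition Drazin_inverse :: "'n::finite qmat \<Rightarrow> 'n qmat"  ("_\<^sup>d" [1000] 999) where
  "A\<^sup>d = (THE X. X ** A ** X = X \<and> A ** X = X ** A \<and> X ** A ^^^ (Ind A + 1) = A ^^^ Ind A)"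

definition CMP_inverse :: "'n::finite qmat \<Rightarrow> 'n qmat" where
  "CMP_inverse A = (A\<^sup>\<dagger> ** A) ** A\<^sup>d ** (A ** A\<^sup>\<dagger>)"

section \<open>Row and column determinants\<close>

text \<open>
  Row and column indices form a finite linearly ordered type, in the role of \<open>{1,\<dots>,n}\<close>.
  A principal submatrix with its labels kept is given by the full matrix \<open>M\<close> together with the
  label set \<open>\<alpha>\<close>: only entries of \<open>M\<close> with both indices in \<open>\<alpha>\<close> are used below.

  \<open>support \<sigma> p\<close> (from \<^theory>\<open>HOL-Combinatorics.Cycles\<close>) is the list
  \<open>[p, \<sigma> p, \<sigma> (\<sigma> p), \<dots>]\<close> running once through the cycle of \<open>p\<close>, so \<open>cycle_prod\<close> is
  \<open>m\<^bsub>p,\<sigma>(p)\<^esub> m\<^bsub>\<sigma>(p),\<sigma>(\<sigma>(p))\<^esub> \<cdots> m\<^bsub>q,p\<^esub>\<close> with \<open>\<sigma>(q) = p\<close>, and \<open>m\<^bsub>p,p\<^esub>\<close> for a fixed point.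
\<close>

definition cycle_prod :: "'n::finite qmat \<Rightarrow> ('n \<Rightarrow> 'n) \<Rightarrow> 'n \<Rightarrow> quat" where
  "cycle_prod M \<sigma> p = prod_list (map (\<lambda>q. M $ q $ \<sigma> q) (support \<sigma> p))"

text \<open>
  First \<open>i\<close>, then the smallest elements of the remaining cycles of \<open>\<sigma>\<close> on \<open>\<alpha>\<close> in increasing
  order; one entry for each cycle.
\<close>

definition cycle_starts :: "('n::{finite,linorder}) set \<Rightarrow> ('n \<Rightarrow> 'n) \<Rightarrow> 'n \<Rightarrow> 'n list" where
  "cycle_starts \<alpha> \<sigma> i =
     i # sorted_list_of_set {p \<in> \<alpha>. i \<notin> set (support \<sigma> p) \<and> (\<forall>q\<in>set (support \<sigma> p). p \<le> q)}"

definition rdet :: "'n::{finite,linorder} \<Rightarrow> 'n qmat \<Rightarrow> 'n set \<Rightarrow> quat" where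
  "rdet i M \<alpha> = (\<Sum>\<sigma> | \<sigma> permutes \<alpha>.
     (- 1) ^ (card \<alpha> - length (cycle_starts \<alpha> \<sigma> i)) *
     prod_list (map (cycle_prod M \<sigma>) (cycle_starts \<alpha> \<sigma> i)))"

text \<open>
  In the column determinant the cycles are written in reverse order. Within the factor of the
  cycle \<open>(j\<^bsub>k+l\<^esub> \<dots> j\<^bsub>k+1\<^esub> j\<^bsub>k\<^esub>)\<close>, which maps \<open>j\<^bsub>k\<^esub>\<close> to \<open>j\<^bsub>k+l\<^esub>\<close>, the product
  \<open>m\<^bsub>j\<^bsub>k\<^esub>,j\<^bsub>k+l\<^esub>\<^esub> \<cdots> m\<^bsub>j\<^bsub>k+1\<^esub>,j\<^bsub>k\<^esub>\<^esub>\<close> again reads \<open>m\<^bsub>p,\<tau>(p)\<^esub> m\<^bsub>\<tau>(p),\<tau>(\<tau>(p))\<^esub> \<cdots>\<close> for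
  \<open>p = j\<^bsub>k\<^esub>\<close>, i.e.\ it is \<open>cycle_prod M \<tau> j\<^bsub>k\<^esub>\<close>.
\<close>

definition cdet :: "'n::{finite,linorder} \<Rightarrow> 'n qmat \<Rightarrow> 'n set \<Rightarrow> quat" where
  "cdet j M \<alpha> = (\<Sum>\<tau> | \<tau> permutes \<alpha>.
     (- 1) ^ (card \<alpha> - length (cycle_starts \<alpha> \<tau> j)) *
     prod_list (map (cycle_prod M \<tau>) (rev (cycle_starts \<alpha> \<tau> j))))"

text \<open>
  The common real value of all row and column determinants of the principal submatrix of a
  Hermitian matrix \<open>M\<close> on a nonempty \<open>\<alpha>\<close>; not meaningful for other arguments.
\<close>

definition hdet :: "'n::{finite,linorder} qmat \<Rightarrow> 'n set \<Rightarrow> real" where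
  "hdet M \<alpha> = (THE d. \<forall>i\<in>\<alpha>. rdet i M \<alpha> = of_real d \<and> cdet i M \<alpha> = of_real d)"

definition index_sets :: "nat \<Rightarrow> 'n set set" where
  "index_sets k = {\<alpha>. finite \<alpha> \<and> card \<alpha> = k}"

definition index_sets_at :: "nat \<Rightarrow> 'n \<Rightarrow> 'n set set" where
  "index_sets_at k j = {\<alpha> \<in> index_sets k. j \<in> \<alpha>}"

definition replace_row :: "'n::finite qmat \<Rightarrow> 'n \<Rightarrow> 'n qvec \<Rightarrow> 'n qmat" where
  "replace_row M j b = (\<chi> p q. if p = j then b $ q else M $ p $ q)"

definition replace_col :: "'n::finite qmat \<Rightarrow> 'n \<Rightarrow> 'n qvec \<Rightarrow> 'n qmat" where
  "replace_col M i c = (\<chi> p q. if q = i then c $ p else M $ p $ q)"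

definition rdet_sum :: "nat \<Rightarrow> 'n::{finite,linorder} \<Rightarrow> 'n qmat \<Rightarrow> 'n qvec \<Rightarrow> quat" where
  "rdet_sum k j M b = (\<Sum>\<alpha>\<in>index_sets_at k j. rdet j (replace_row M j b) \<alpha>)"

definition cdet_sum :: "nat \<Rightarrow> 'n::{finite,linorder} \<Rightarrow> 'n qmat \<Rightarrow> 'n qvec \<Rightarrow> quat" where
  "cdet_sum k i M c = (\<Sum>\<beta>\<in>index_sets_at k i. cdet i (replace_col M i c) \<beta>)"

definition minor_sum :: "nat \<Rightarrow> 'n::{finite,linorder} qmat \<Rightarrow> real" where
  "minor_sum k M = (\<Sum>\<beta>\<in>index_sets k. hdet M \<beta>)"

text \<open>
  Pitfall: for the CMP inverse of \<open>A\<close> with index \<open>m\<close>, the matrix \<open>Ghat\<close> of the general case has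
  to be \<open>A\<^sup>H ** A ^^^ (m + 1) ** G\<close>. It is sometimes written with \<open>A ^^^ 2\<close>, which
  agrees with this for \<open>m = 1\<close> but is wrong otherwise: the one by one matrix \<open>A = 2\<close>, with
  \<open>m = 0\<close> and \<open>G = 8\<close>, would get \<open>64 / (4\<^sup>2 * 4) = 1\<close> as its CMP inverse instead of \<open>1 / 2\<close>.
\<close>

end

theory Submission
  imports Defs
begin

text \<open>
  Sorting the permutations by the cycle through \<open>i\<close> turns \<open>rdet i M \<alpha>\<close> into a sum over closed
  walks from \<open>i\<close>, weighted by the determinant of what remains. For Hermitian \<open>M\<close>, reversing the walk
  makes the sum real, and rotating it makes it independent of \<open>i\<close>; a row replaced by another row of \<open>M\<close>
  gives \<open>0\<close>. Summed over all principal submatrices of size \<open>k\<close>, this says that the matrices \<open>R\<^sub>k\<close> of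
  the left linear maps \<open>b \<mapsto> rdet_sum k j M b\<close> and the sums \<open>d\<^sub>k\<close> of principal minors satisfy the
  Faddeev--LeVerrier recursion \<open>M R\<^sub>k + R\<^bsub>k+1\<^esub> = d\<^sub>k I\<close>, with \<open>k d\<^sub>k\<close> the real trace of \<open>M R\<^sub>k\<close>.

  If \<open>t\<close> is the last index with \<open>d\<^sub>t \<noteq> 0\<close>, then \<open>M R\<^sub>t M = d\<^sub>t M\<close>, so \<open>M R\<^sub>t / d\<^sub>t\<close> is the
  projector onto the range of \<open>M\<close>; its trace is both \<open>t\<close> and the rank of \<open>M\<close>. Hence the sums of
  determinants in the theorem are multiplications by multiples of an inner inverse of \<open>M\<close>, and everything
  reduces to \<open>A\<^sup>\<dagger> = A\<^sup>H (A A\<^sup>H)\<^sup>-\<close>, to \<open>A\<^sup>d = A\<^sup>m (A\<^bsup>2m+1\<^esup>)\<^sup>\<dagger> A\<^sup>m\<close>, and for Hermitian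
  \<open>A\<close> to \<open>A\<^sup>d = A\<^sup>m (A\<^bsup>m+1\<^esup>)\<^sup>-\<close>, where the superscript minus marks that inner inverse.
\<close>

section \<open>Row determinants as sums over closed walks\<close>

text \<open>The starting point is kept apart from the list of later vertices, so a closed walk from
  \<open>i\<close> through \<open>L\<close> is \<open>walk M i (L @ [i])\<close>.\<close>

primrec walk :: "'n::finite qmat \<Rightarrow> 'n \<Rightarrow> 'n list \<Rightarrow> quat" where
  "walk M p [] = 1"
| "walk M p (q # qs) = M $ p $ q * walk M q qs"

lemma walk_append: "walk M p (xs @ y # ys) = walk M p (xs @ [y]) * walk M y ys"
  by (induction xs arbitrary: p) (simp_all add: mult.assoc)

text \<open>The row of the last vertex \<open>r\<close> is never read.\<close>

lemma walk_cong:
  assumes "\<And>q. q \<in> insert p (set xs) \<Longrightarrow> M $ q = N $ q"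
  shows "walk M p (xs @ [r]) = walk N p (xs @ [r])"
  using assms by (induction xs arbitrary: p) simp_all

lemma prod_list_eq_walk:
  assumes "map \<sigma> (p # L) = L @ [r]"
  shows "prod_list (map (\<lambda>q. M $ q $ \<sigma> q) (p # L)) = walk M p (L @ [r])"
  using assms by (induction L arbitrary: p) auto

text \<open>A list \<open>L\<close> in \<open>paths i \<alpha>\<close> stands for the cycle \<open>i # L\<close> starting at \<open>i\<close>.\<close>

definition paths :: "'n \<Rightarrow> 'n set \<Rightarrow> 'n list set" where
  "paths i \<alpha> = {L. distinct (i # L) \<and> set L \<subseteq> \<alpha>}"

lemma finite_paths [simp, intro]: "finite (paths i (\<alpha> :: 'n::finite set))"
  by (rule finite_subset[OF _ finite_subset_distinct[of \<alpha>]]) (auto simp: paths_def)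

lemma minus_one_power_left_commute: "x * ((- 1) ^ n * y) = (- 1) ^ n * (x * (y :: 'a :: ring_1))"
  by (cases "even n") simp_all

definition leaders :: "('n::{finite,linorder}) set \<Rightarrow> ('n \<Rightarrow> 'n) \<Rightarrow> 'n list" where
  "leaders \<gamma> \<tau> = sorted_list_of_set {p \<in> \<gamma>. \<forall>q\<in>set (support \<tau> p). p \<le> q}"

text \<open>Every cycle starts at its least element, so no index is preferred. This suits the set
  left over after removing a cycle, which may be empty; the value is then 1.\<close>

definition qdet :: "('n::{finite,linorder}) qmat \<Rightarrow> 'n set \<Rightarrow> quat" where
  "qdet M \<gamma> = (\<Sum>\<tau> | \<tau> permutes \<gamma>.
     (- 1) ^ (card \<gamma> - length (leaders \<gamma> \<tau>)) * prod_list (map (cycle_prod M \<tau>) (leaders \<gamma> \<tau>)))"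

lemma qdet_empty [simp]: "qdet M {} = 1"
  by (simp add: qdet_def leaders_def)

lemma length_leaders_le: "length (leaders \<gamma> \<tau>) \<le> card \<gamma>"
  by (auto simp: leaders_def intro: card_mono)

section \<open>Cycles of a permutation and the gluing of one cycle\<close>

lemma funpow_cong_on:
  assumes "\<forall>x\<in>S. \<sigma> x = \<tau> x \<and> \<tau> x \<in> S" "p \<in> S"
  shows "(\<sigma> ^^ k) p = (\<tau> ^^ k) p \<and> (\<tau> ^^ k) p \<in> S"
  using assms by (induction k) simp_all

text \<open>Taken with \<open>\<tau>\<close> equal to \<open>\<sigma>\<close>, the second part says
  that cycles stay inside an invariant set.\<close>

lemma support_cong_on:
  assumes "\<forall>x\<in>S. \<sigma> x = \<tau> x \<and> \<tau> x \<in> S" "p \<in> S"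
  shows "support \<sigma> p = support \<tau> p" "set (support \<tau> p) \<subseteq> S"
  using funpow_cong_on[OF assms] by (auto simp: least_power_def)

text \<open>Powers of the cycle rotate the list, so the \<open>k\<close>-th power sends
  \<open>i\<close> to entry \<open>k\<close> modulo the length; distinctness makes the length the
  least period.\<close>

lemma support_cycle_of_list:
  assumes "distinct (i # L)"
  shows "support (cycle_of_list (i # L)) i = i # L"
proof -
  let ?cs = "i # L" and ?c = "cycle_of_list (i # L)"
  have pw: "(?c ^^ k) i = ?cs ! (k mod length ?cs)" for k
  proof -
    have "map (?c ^^ k) ?cs ! 0 = rotate k ?cs ! 0"
      by (simp only: cyclic_rotation[OF assms])
    then show ?thesis
      by (simp add: nth_rotate)
  qed
  have lp: "least_power ?c i = length ?cs"
    unfolding least_power_def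
  proof (rule Least_equality)
    show "(?c ^^ length ?cs) i = i \<and> 0 < length ?cs"
      unfolding pw by simp
  next
    fix k assume k: "(?c ^^ k) i = i \<and> 0 < k"
    show "length ?cs \<le> k"
    proof (rule ccontr)
      assume "\<not> length ?cs \<le> k"
      then have "?cs ! k = ?cs ! 0" "k < length ?cs"
        using k by (auto simp: pw)
      then show False
        using k assms nth_eq_iff_index_eq[of ?cs k 0] by simp
    qed
  qed
  show ?thesis
    unfolding lp by (rule nth_equalityI) (simp_all only: pw length_map length_upt nth_map nth_upt mod_less diff_zero add_0)
qed

lemma support_refl:
  assumes "permutation \<sigma>" shows "p \<in> set (support \<sigma> p)"
  using least_power_of_permutation(2)[OF assms, of p] by (auto intro: image_eqI[of _ _ 0])

lemma support_sym:
  assumes "permutation \<sigma>" "q \<in> set (support \<sigma> p)" shows "p \<in> set (support \<sigma> q)"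
  using disjoint_support'[OF assms(1), of q p] disjoint_support'[OF assms(1), of p q] assms(2)
  by blast

text \<open>The case split gives the values at once; \<open>attach_cycle_eq\<close> recovers the
  product of permutations from which \<open>permutes\<close> follows.\<close>

definition attach_cycle :: "'n list \<Rightarrow> ('n \<Rightarrow> 'n) \<Rightarrow> 'n \<Rightarrow> 'n" where
  "attach_cycle cs \<tau> x = (if x \<in> set cs then cycle_of_list cs x else \<tau> x)"

lemma cycle_of_list_in: "x \<in> set cs \<Longrightarrow> cycle_of_list cs x \<in> set cs"
  using permutes_in_image[OF cycle_permutes] by metis

lemma attach_cycle_eq:
  assumes "\<tau> permutes \<gamma>" "set cs \<inter> \<gamma> = {}"
  shows "attach_cycle cs \<tau> = cycle_of_list cs \<circ> \<tau>"
proof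
  fix x show "attach_cycle cs \<tau> x = (cycle_of_list cs \<circ> \<tau>) x"
  proof (cases "x \<in> set cs")
    case True
    then have "\<tau> x = x" using assms by (auto intro: permutes_not_in)
    then show ?thesis using True by (simp add: attach_cycle_def)
  next
    case False
    have "\<tau> x \<notin> set cs"
      using False assms permutes_in_image[OF assms(1), of x] permutes_not_in[OF assms(1), of x] by fastforce
    then show ?thesis using False by (simp add: attach_cycle_def id_outside_supp)
  qed
qed

lemma attach_cycle_permutes:
  assumes "\<tau> permutes \<gamma>" "set cs \<inter> \<gamma> = {}"
  shows "attach_cycle cs \<tau> permutes (set cs \<union> \<gamma>)"
  unfolding attach_cycle_eq[OF assms]
  by (rule permutes_compose)
    (use assms(1) cycle_permutes[of cs] in \<open>auto intro: permutes_subset\<close>)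

text \<open>For the bijection behind \<open>rdet_eq_sum_paths\<close>: each ingredient of a summand
  of \<open>rdet\<close> splits into a part for the cycle \<open>i # L\<close> and a part for
  \<open>\<tau>\<close>.\<close>

lemma
  fixes \<alpha> :: "('n::{finite,linorder}) set"
  assumes i: "i \<in> \<alpha>" and L: "L \<in> paths i \<alpha>" and \<tau>: "\<tau> permutes (\<alpha> - set (i # L))"
  defines "\<sigma> \<equiv> attach_cycle (i # L) \<tau>"
  shows attach_cycle_permutes': "\<sigma> permutes \<alpha>"
    and support_attach_cycle: "support \<sigma> i = i # L"
    and cycle_prod_attach_cycle: "cycle_prod M \<sigma> i = walk M i (L @ [i])"
    and cycle_prod_attach_cycle': "p \<in> \<alpha> - set (i # L) \<Longrightarrow> cycle_prod M \<sigma> p = cycle_prod M \<tau> p"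
    and cycle_starts_attach_cycle: "cycle_starts \<alpha> \<sigma> i = i # leaders (\<alpha> - set (i # L)) \<tau>"
proof -
  let ?cs = "i # L" and ?\<gamma> = "\<alpha> - set (i # L)"
  have d: "distinct ?cs" and sub: "set ?cs \<subseteq> \<alpha>"
    using L i by (auto simp: paths_def)
  show perm: "\<sigma> permutes \<alpha>"
    using attach_cycle_permutes[OF \<tau>, of ?cs] sub i unfolding \<sigma>_def by (simp add: Un_absorb1 insert_absorb)
  then have pm: "permutation \<sigma>"
    using finite permutation_permutes by blast
  have on_cs: "\<forall>x\<in>set ?cs. \<sigma> x = cycle_of_list ?cs x \<and> cycle_of_list ?cs x \<in> set ?cs"
    by (simp add: \<sigma>_def attach_cycle_def cycle_of_list_in del: list.set)
  have on_\<gamma>: "\<forall>x\<in>?\<gamma>. \<sigma> x = \<tau> x \<and> \<tau> x \<in> ?\<gamma>"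
    using permutes_in_image[OF \<tau>] by (simp add: \<sigma>_def attach_cycle_def)
  show supp: "support \<sigma> i = i # L"
    using support_cong_on(1)[of "set ?cs" \<sigma> "cycle_of_list ?cs" i, OF on_cs] support_cycle_of_list[OF d] by simp
  have "map \<sigma> ?cs = map (cycle_of_list ?cs ^^ 1) ?cs"
  proof (rule map_cong[OF refl])
    fix x assume "x \<in> set ?cs"
    then have "\<sigma> x = cycle_of_list ?cs x"
      using on_cs by blast
    then show "\<sigma> x = (cycle_of_list ?cs ^^ 1) x"
      by (simp only: One_nat_def funpow.simps comp_id)
  qed
  also have "\<dots> = L @ [i]"
    unfolding cyclic_rotation[OF d] by simp
  finally show "cycle_prod M \<sigma> i = walk M i (L @ [i])"
    unfolding cycle_prod_def supp by (rule prod_list_eq_walk)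
  show cp: "cycle_prod M \<sigma> p = cycle_prod M \<tau> p" if "p \<in> ?\<gamma>" for p
  proof -
    note s = support_cong_on[of ?\<gamma> \<sigma> \<tau> p, OF on_\<gamma> that]
    have "map (\<lambda>q. M $ q $ \<sigma> q) (support \<sigma> p) = map (\<lambda>q. M $ q $ \<tau> q) (support \<tau> p)"
    proof (rule map_cong[OF s(1)])
      fix q assume "q \<in> set (support \<tau> p)"
      then have "\<sigma> q = \<tau> q"
        using s(2) on_\<gamma> by blast
      then show "M $ q $ \<sigma> q = M $ q $ \<tau> q"
        by (rule arg_cong)
    qed
    then show ?thesis
      unfolding cycle_prod_def by (rule arg_cong)
  qed
  \<comment> \<open>Points of \<open>\<alpha>\<close> outside \<open>?\<gamma>\<close> lie on the
    cycle of \<open>i\<close>, so the condition on \<open>i\<close> in \<open>cycle_starts\<close>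
    removes exactly them.\<close>
  have "p \<in> \<alpha> \<and> i \<notin> set (support \<sigma> p) \<and> (\<forall>q\<in>set (support \<sigma> p). p \<le> q) \<longleftrightarrow>
        p \<in> ?\<gamma> \<and> (\<forall>q\<in>set (support \<tau> p). p \<le> q)" for p
  proof (cases "p \<in> ?\<gamma>")
    case True
    note s = support_cong_on[of ?\<gamma> \<sigma> \<tau> p, OF on_\<gamma> True]
    have "p \<in> \<alpha> \<and> i \<notin> P \<and> (\<forall>q\<in>P. p \<le> q) \<longleftrightarrow> p \<in> ?\<gamma> \<and> (\<forall>q\<in>P. p \<le> q)" if "P \<subseteq> ?\<gamma>" for P
      using that True by auto
    from this[OF s(2)] show ?thesis
      unfolding s(1) .
  next
    case False
    have "p \<in> \<alpha> \<Longrightarrow> i \<in> set (support \<sigma> p)"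
      by (rule support_sym[OF pm], unfold supp) (use False in blast)
    then show ?thesis using False by blast
  qed
  then show "cycle_starts \<alpha> \<sigma> i = i # leaders ?\<gamma> \<tau>"
    unfolding cycle_starts_def leaders_def by presburger
qed

text \<open>A permutation of \<open>\<alpha>\<close> amounts to its cycle \<open>i # L\<close>
  together with a permutation of the rest. That cycle has \<open>length L + 1\<close> points, so it
  contributes \<open>length L\<close> to the exponent of the sign.\<close>

theorem rdet_eq_sum_paths:
  fixes \<alpha> :: "('n::{finite,linorder}) set"
  assumes i: "i \<in> \<alpha>"
  shows "rdet i M \<alpha> = (\<Sum>L\<in>paths i \<alpha>. (- 1) ^ length L * walk M i (L @ [i]) * qdet M (\<alpha> - set (i # L)))"
proof -
  let ?T = "\<lambda>L. {\<tau>. \<tau> permutes (\<alpha> - set (i # L))}"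
  let ?g = "\<lambda>\<sigma>. (- 1) ^ (card \<alpha> - length (cycle_starts \<alpha> \<sigma> i)) * prod_list (map (cycle_prod M \<sigma>) (cycle_starts \<alpha> \<sigma> i))"
  let ?h = "\<lambda>L \<tau>. (- 1) ^ length L * walk M i (L @ [i]) *
     ((- 1) ^ (card (\<alpha> - set (i # L)) - length (leaders (\<alpha> - set (i # L)) \<tau>)) *
       prod_list (map (cycle_prod M \<tau>) (leaders (\<alpha> - set (i # L)) \<tau>)))"
  have "(\<Sum>\<sigma> | \<sigma> permutes \<alpha>. ?g \<sigma>) = (\<Sum>(L, \<tau>)\<in>Sigma (paths i \<alpha>) ?T. ?h L \<tau>)"
  \<comment> \<open>Backwards, the cycle of \<open>i\<close> is read off from
    \<open>support\<close>, and the permutation is made trivial on it.\<close>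
  proof (rule sym, rule sum.reindex_bij_witness[where
        i = "\<lambda>\<sigma>. (tl (support \<sigma> i), \<lambda>x. if x \<in> set (support \<sigma> i) then x else \<sigma> x)" and
        j = "\<lambda>(L, \<tau>). attach_cycle (i # L) \<tau>"])
    fix x assume "x \<in> Sigma (paths i \<alpha>) ?T"
    then obtain L \<tau> where x: "x = (L, \<tau>)" and L: "L \<in> paths i \<alpha>" and \<tau>: "\<tau> permutes (\<alpha> - set (i # L))"
      by auto
    let ?\<sigma> = "attach_cycle (i # L) \<tau>" and ?\<gamma> = "\<alpha> - set (i # L)"
    note ac = attach_cycle_permutes'[OF i L \<tau>] support_attach_cycle[OF i L \<tau>]
      cycle_prod_attach_cycle[OF i L \<tau>] cycle_prod_attach_cycle'[OF i L \<tau>]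
      cycle_starts_attach_cycle[OF i L \<tau>]
    show "(case x of (L, \<tau>) \<Rightarrow> attach_cycle (i # L) \<tau>) \<in> {\<sigma>. \<sigma> permutes \<alpha>}"
      using ac(1) x by simp
    have "(\<lambda>x. if x \<in> set (i # L) then x else ?\<sigma> x) = \<tau>"
      using permutes_not_in[OF \<tau>] by (auto simp: attach_cycle_def)
    then show "(tl (support (case x of (L, \<tau>) \<Rightarrow> attach_cycle (i # L) \<tau>) i),
        \<lambda>y. if y \<in> set (support (case x of (L, \<tau>) \<Rightarrow> attach_cycle (i # L) \<tau>) i) then y
          else (case x of (L, \<tau>) \<Rightarrow> attach_cycle (i # L) \<tau>) y) = x"
      unfolding x prod.case ac(2) by simp
    have "card \<alpha> = Suc (length L) + card ?\<gamma>"
      using L i card_Un_disjoint[of "set (i # L)" ?\<gamma>] distinct_card[of "i # L"]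
      by (simp add: paths_def insert_absorb Un_absorb1)
    then have sgn: "card \<alpha> - length (cycle_starts \<alpha> ?\<sigma> i) = length L + (card ?\<gamma> - length (leaders ?\<gamma> \<tau>))"
      using length_leaders_le[of ?\<gamma> \<tau>] unfolding ac(5) by simp
    have "map (cycle_prod M ?\<sigma>) (leaders ?\<gamma> \<tau>) = map (cycle_prod M \<tau>) (leaders ?\<gamma> \<tau>)"
      by (rule map_cong) (auto simp: leaders_def intro!: ac(4))
    then have "?g ?\<sigma> = ?h L \<tau>"
      unfolding sgn unfolding ac(5) by (simp only: list.map prod_list.Cons ac(3) power_add mult.assoc
          minus_one_power_left_commute[of "walk M i (L @ [i])"])
    then show "?g (case x of (L, \<tau>) \<Rightarrow> attach_cycle (i # L) \<tau>) = (case x of (L, \<tau>) \<Rightarrow> ?h L \<tau>)"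
      by (simp add: x)
  next
    fix \<sigma> assume "\<sigma> \<in> {\<sigma>. \<sigma> permutes \<alpha>}"
    then have \<sigma>: "\<sigma> permutes \<alpha>" by simp
    then have pm: "permutation \<sigma>" using finite permutation_permutes by blast
    have ne: "support \<sigma> i = i # tl (support \<sigma> i)"
      using least_power_of_permutation(2)[OF pm, of i] by (cases "least_power \<sigma> i") (simp_all add: upt_conv_Cons del: upt_Suc)
    have sub: "set (support \<sigma> i) \<subseteq> \<alpha>"
      using support_cong_on(2)[of \<alpha> \<sigma> \<sigma> i] permutes_in_image[OF \<sigma>] i by blast
    have L: "tl (support \<sigma> i) \<in> paths i \<alpha>"
      using cycle_of_permutation[OF pm, of i] sub unfolding paths_def
      by (subst (asm) (1 2) ne) auto
    let ?\<tau> = "\<lambda>x. if x \<in> set (support \<sigma> i) then x else \<sigma> x"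
    have "?\<tau> = (\<lambda>y. if y \<in> \<alpha> - set (support \<sigma> i) then \<sigma> y else y)"
      using permutes_not_in[OF \<sigma>] by auto
    then have "?\<tau> permutes (\<alpha> - set (support \<sigma> i))"
      using semidecomposition[OF \<sigma> finite, of i] by (simp only:)
    then show "(tl (support \<sigma> i), ?\<tau>) \<in> Sigma (paths i \<alpha>) ?T"
      using L by (simp only: mem_Sigma_iff mem_Collect_eq ne[symmetric] simp_thms)
    show "(case (tl (support \<sigma> i), ?\<tau>) of (L, \<tau>) \<Rightarrow> attach_cycle (i # L) \<tau>) = \<sigma>"
      unfolding prod.case ne[symmetric]
      using cycle_restrict[OF pm] by (auto simp: attach_cycle_def simp del: set_map)
  qed
  also have "\<dots> = (\<Sum>L\<in>paths i \<alpha>. \<Sum>\<tau>\<in>?T L. ?h L \<tau>)"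
    by (rule sum.Sigma[symmetric]) (auto intro: finite_permutations)
  finally show ?thesis
    unfolding rdet_def qdet_def sum_distrib_left .
qed

text \<open>The cycle of \<open>Min \<gamma>\<close> has \<open>Min \<gamma>\<close> as its least
  element, which also comes first among the leaders.\<close>

lemma qdet_eq_rdet:
  assumes "\<gamma> \<noteq> {}"
  shows "qdet M \<gamma> = rdet (Min \<gamma>) M \<gamma>"
proof -
  have "cycle_starts \<gamma> \<sigma> (Min \<gamma>) = leaders \<gamma> \<sigma>" if \<sigma>: "\<sigma> permutes \<gamma>" for \<sigma>
  proof -
    have pm: "permutation \<sigma>" using \<sigma> finite permutation_permutes by blast
    let ?S = "{p \<in> \<gamma>. \<forall>q\<in>set (support \<sigma> p). p \<le> q}"
    let ?S' = "{p \<in> \<gamma>. Min \<gamma> \<notin> set (support \<sigma> p) \<and> (\<forall>q\<in>set (support \<sigma> p). p \<le> q)}"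
    have m: "Min \<gamma> \<in> \<gamma>" using assms by simp
    have sub: "set (support \<sigma> p) \<subseteq> \<gamma>" if "p \<in> \<gamma>" for p
      using support_cong_on(2)[of \<gamma> \<sigma> \<sigma> p] permutes_in_image[OF \<sigma>] that by blast
    have "p = Min \<gamma>" if "p \<in> ?S" "Min \<gamma> \<in> set (support \<sigma> p)" for p
      using that by (intro antisym) auto
    moreover have "Min \<gamma> \<in> ?S" using m sub[OF m] by (auto simp del: set_map)
    moreover have "Min \<gamma> \<notin> ?S'" using support_refl[OF pm, of "Min \<gamma>"] by blast
    ultimately have S: "?S - {Min \<gamma>} = ?S'" "Min \<gamma> \<in> ?S" by blast+
    have "Min ?S = Min \<gamma>"
      using S(2) by (intro Min_eqI) auto
    then have "sorted_list_of_set ?S = Min \<gamma> # sorted_list_of_set ?S'"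
      using sorted_list_of_set_nonempty[of ?S] S by (metis (no_types, lifting) empty_iff finite)
    then show ?thesis
      unfolding cycle_starts_def leaders_def by (simp only:)
  qed
  then show ?thesis
    unfolding qdet_def rdet_def by (intro sum.cong) simp_all
qed

section \<open>Determinants of Hermitian matrices\<close>

lemma qcnj_add [simp]: "qcnj (x + y) = qcnj x + qcnj y"
  by (simp add: quat_eq_iff)

lemma qcnj_0 [simp]: "qcnj 0 = 0"
  by (simp add: quat_eq_iff)

lemma qcnj_1 [simp]: "qcnj 1 = 1"
  by (simp add: quat_eq_iff)

lemma qcnj_mult [simp]: "qcnj (x * y) = qcnj y * qcnj x"
  by (simp add: quat_eq_iff quat_mult_sel algebra_simps)

lemma qcnj_qcnj [simp]: "qcnj (qcnj x) = x"
  by (simp add: quat_eq_iff)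

lemma qcnj_sum: "qcnj (sum f S) = (\<Sum>x\<in>S. qcnj (f x))"
  by (induction S rule: infinite_finite_induct) simp_all

lemma qcnj_prod_list: "qcnj (prod_list xs) = prod_list (rev (map qcnj xs))"
  by (induction xs) simp_all

lemma quat_of_real_sel [simp]:
  "qre (of_real r) = r" "qim_i (of_real r) = 0" "qim_j (of_real r) = 0" "qim_k (of_real r) = 0"
  by (simp_all add: of_real_def)

lemma qcnj_of_real [simp]: "qcnj (of_real r) = of_real r"
  by (simp add: quat_eq_iff)

lemma of_real_qre: "qcnj x = x \<Longrightarrow> of_real (qre x) = x"
  by (simp add: quat_eq_iff)

lemma quat_of_real_commute: "of_real r * (x :: quat) = x * of_real r"
  by (simp add: quat_eq_iff quat_mult_sel)

text \<open>Real parts are cyclic although the product is not commutative; the rotation of walks and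
  the trace arguments rest on this.\<close>

lemma qre_mult_commute: "qre (x * y) = qre (y * x)"
  by (simp add: quat_mult_sel algebra_simps)

lemma qre_sum: "qre (sum f S) = (\<Sum>x\<in>S. qre (f x))"
  by (induction S rule: infinite_finite_induct) simp_all

lemma qre_mult_of_real [simp]: "qre (x * of_real r) = qre x * r"
  by (simp add: quat_mult_sel)

lemma qre_minus_one_power_mult [simp]: "qre ((- 1) ^ n * x) = (- 1) ^ n * qre x"
  by (cases "even n") simp_all

text \<open>Signs and, in \<open>quat_mult_of_real\<close>, real factors become scalars, which move
  freely past noncommuting factors.\<close>

lemma minus_one_power_mult_quat: "(- 1) ^ n * (x :: quat) = ((- 1) ^ n :: real) *\<^sub>R x"
  by (cases "even n") simp_all

lemma quat_mult_of_real: "x * of_real r = r *\<^sub>R (x :: quat)"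
  by (simp add: quat_eq_iff quat_mult_sel)

lemma qcnj_scaleR [simp]: "qcnj (r *\<^sub>R x) = r *\<^sub>R qcnj x"
  by (simp add: quat_eq_iff)

lemma adj_nth [simp]: "A\<^sup>H $ i $ j = qcnj (A $ j $ i)"
  by (simp add: adj_def)

lemma adj_adj [simp]: "(A\<^sup>H)\<^sup>H = A"
  by (simp add: vec_eq_iff)

text \<open>Conjugation reverses the order of the factors, and passing to \<open>M\<^sup>H\<close>
  reverses each step.\<close>

lemma qcnj_walk: "qcnj (walk M p (xs @ [r])) = walk (M\<^sup>H) r (rev xs @ [p])"
proof (induction xs arbitrary: p)
  case (Cons x xs)
  then show ?case
    using walk_append[of "M\<^sup>H" r "rev xs" x "[p]"] by simp
qed simp

text \<open>The same pair encodes the single cycle \<open>i # A @ j # B\<close> and the two cycles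
  \<open>i # A\<close> and \<open>j # B\<close>, so that sums over either kind can be
  compared.\<close>

definition path_pairs :: "'n \<Rightarrow> 'n \<Rightarrow> 'n set \<Rightarrow> ('n list \<times> 'n list) set" where
  "path_pairs i j \<alpha> = {(A, B). distinct (i # A @ j # B) \<and> set A \<subseteq> \<alpha> \<and> set B \<subseteq> \<alpha>}"

lemma sum_path_pairs_swap:
  "(\<Sum>(A, B)\<in>path_pairs i j \<alpha>. f A B) = (\<Sum>(A, B)\<in>path_pairs j i \<alpha>. f B A)"
  by (rule sum.reindex_bij_witness[where i = prod.swap and j = prod.swap]) (auto simp: path_pairs_def)

lemma sum_path_pairs_swap':
  "(\<Sum>(A, B)\<in>path_pairs i j \<alpha>. f A B) = (\<Sum>(A, B)\<in>path_pairs i j \<alpha>. f B A)"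
  by (rule sum.reindex_bij_witness[where i = prod.swap and j = prod.swap]) (auto simp: path_pairs_def)

text \<open>Pairs read as two cycles: \<open>B\<close> runs in what \<open>i # A\<close>
  leaves.\<close>

lemma sum_path_pairs_disjoint:
  fixes \<alpha> :: "'n::finite set"
  assumes "i \<noteq> j"
  shows "(\<Sum>(A, B)\<in>path_pairs i j \<alpha>. f A B) =
    (\<Sum>A | A \<in> paths i \<alpha> \<and> j \<notin> set A. \<Sum>B\<in>paths j (\<alpha> - set (i # A)). f A B)"
proof -
  have "path_pairs i j \<alpha> = Sigma {A \<in> paths i \<alpha>. j \<notin> set A} (\<lambda>A. paths j (\<alpha> - set (i # A)))"
    using assms by (auto simp: path_pairs_def paths_def)
  then show ?thesis
    by (simp only:) (rule sum.Sigma[symmetric], auto)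
qed

text \<open>Pairs read as one cycle from \<open>i\<close>, cut at its only visit to
  \<open>j\<close>.\<close>

lemma sum_path_pairs_through:
  fixes \<alpha> :: "'n::finite set"
  assumes "i \<noteq> j" "j \<in> \<alpha>"
  shows "(\<Sum>(A, B)\<in>path_pairs i j \<alpha>. f (A @ j # B)) = (\<Sum>L | L \<in> paths i \<alpha> \<and> j \<in> set L. f L)"
proof (rule sum.reindex_bij_witness[where j = "\<lambda>(A, B). A @ j # B" and
      i = "\<lambda>L. (takeWhile (\<lambda>x. x \<noteq> j) L, tl (dropWhile (\<lambda>x. x \<noteq> j) L))"])
  fix x assume "x \<in> path_pairs i j \<alpha>"
  then obtain A B where x: "x = (A, B)" "distinct (i # A @ j # B)" "set A \<subseteq> \<alpha>" "set B \<subseteq> \<alpha>"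
    by (auto simp: path_pairs_def)
  then have "takeWhile (\<lambda>x. x \<noteq> j) (A @ j # B) = A" "dropWhile (\<lambda>x. x \<noteq> j) (A @ j # B) = j # B"
    by (subst takeWhile_append2 dropWhile_append2; auto)+
  then show "(takeWhile (\<lambda>x. x \<noteq> j) (case x of (A, B) \<Rightarrow> A @ j # B),
      tl (dropWhile (\<lambda>x. x \<noteq> j) (case x of (A, B) \<Rightarrow> A @ j # B))) = x"
    using x by simp
  show "(case x of (A, B) \<Rightarrow> A @ j # B) \<in> {L \<in> paths i \<alpha>. j \<in> set L}"
    using x assms by (auto simp: paths_def)
  show "f (case x of (A, B) \<Rightarrow> A @ j # B) = (case x of (A, B) \<Rightarrow> f (A @ j # B))"
    by (simp add: x)
next
  fix L assume "L \<in> {L \<in> paths i \<alpha>. j \<in> set L}"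
  then have L: "distinct (i # L)" "set L \<subseteq> \<alpha>" "j \<in> set L"
    by (auto simp: paths_def)
  then obtain A B where AB: "L = A @ j # B" "j \<notin> set A"
    by (meson split_list_first)
  then have "takeWhile (\<lambda>x. x \<noteq> j) L = A" "dropWhile (\<lambda>x. x \<noteq> j) L = j # B"
    by (simp_all only: AB(1), (subst takeWhile_append2 dropWhile_append2; auto)+)
  then show "(case (takeWhile (\<lambda>x. x \<noteq> j) L, tl (dropWhile (\<lambda>x. x \<noteq> j) L)) of (A, B) \<Rightarrow> A @ j # B) = L"
    "(takeWhile (\<lambda>x. x \<noteq> j) L, tl (dropWhile (\<lambda>x. x \<noteq> j) L)) \<in> path_pairs i j \<alpha>"
    using L AB by (auto simp: path_pairs_def)
qed

lemma sum_paths_split: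
  fixes \<alpha> :: "'n::finite set" and f :: "'n list \<Rightarrow> 'a::comm_monoid_add"
  assumes "i \<noteq> j" "j \<in> \<alpha>"
  shows "(\<Sum>L\<in>paths i \<alpha>. f L) =
    (\<Sum>(A, B)\<in>path_pairs i j \<alpha>. f (A @ j # B)) + (\<Sum>L | L \<in> paths i \<alpha> \<and> j \<notin> set L. f L)"
proof -
  have "(\<Sum>L\<in>paths i \<alpha>. f L) =
    (\<Sum>L\<in>{L \<in> paths i \<alpha>. j \<in> set L} \<union> {L \<in> paths i \<alpha>. j \<notin> set L}. f L)"
    by (rule sum.cong) auto
  also have "\<dots> = (\<Sum>L | L \<in> paths i \<alpha> \<and> j \<in> set L. f L) + (\<Sum>L | L \<in> paths i \<alpha> \<and> j \<notin> set L. f L)"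
    by (rule sum.union_disjoint) auto
  finally show ?thesis
    by (simp only: sum_path_pairs_through[OF assms])
qed

text \<open>The real part of the expansion of \<open>rdet\<close> when the complementary
  determinants are real. Unlike the quaternion summands, these summands allow the walk to be
  rotated.\<close>

definition cycle_expansion :: "('n::{finite,linorder}) qmat \<Rightarrow> 'n \<Rightarrow> 'n set \<Rightarrow> real" where
  "cycle_expansion M i \<alpha> =
     (\<Sum>L\<in>paths i \<alpha>. (- 1) ^ length L * qre (walk M i (L @ [i])) * qre (qdet M (\<alpha> - set (i # L))))"

text \<open>Conjugation turns each walk into its reverse, and reversal permutes
  \<open>paths i \<alpha>\<close>, so the sum equals its own conjugate.\<close>

lemma rdet_eq_cycle_expansion:
  assumes herm: "hermitian M" and i: "i \<in> \<alpha>"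
    and real: "\<And>\<beta>. \<beta> \<subset> \<alpha> \<Longrightarrow> of_real (qre (qdet M \<beta>)) = qdet M \<beta>"
  shows "rdet i M \<alpha> = of_real (cycle_expansion M i \<alpha>)"
proof -
  have MH: "M\<^sup>H = M" using herm by (simp add: hermitian_def)
  define d where "d \<beta> = qre (qdet M \<beta>)" for \<beta>
  have D: "qdet M (\<alpha> - set (i # L)) = of_real (d (\<alpha> - set (i # L)))" for L
    unfolding d_def using i by (intro real[symmetric]) auto
  have eq: "rdet i M \<alpha> = (\<Sum>L\<in>paths i \<alpha>. (- 1) ^ length L * walk M i (L @ [i]) * of_real (d (\<alpha> - set (i # L))))"
    by (simp only: rdet_eq_sum_paths[OF i] D)
  have "qcnj (rdet i M \<alpha>) = (\<Sum>L\<in>paths i \<alpha>. (- 1) ^ length L * walk M i (rev L @ [i]) * of_real (d (\<alpha> - set (i # L))))"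
    unfolding eq qcnj_sum
    by (rule sum.cong) (simp_all add: minus_one_power_mult_quat quat_mult_of_real qcnj_walk MH)
  also have "\<dots> = rdet i M \<alpha>"
    unfolding eq by (rule sum.reindex_bij_witness[where i = rev and j = rev]) (auto simp: paths_def)
  finally have "rdet i M \<alpha> = of_real (qre (rdet i M \<alpha>))"
    by (simp add: of_real_qre)
  also have "qre (rdet i M \<alpha>) = cycle_expansion M i \<alpha>"
    unfolding eq cycle_expansion_def qre_sum qre_mult_of_real qre_minus_one_power_mult d_def ..
  finally show ?thesis .
qed

text \<open>Cycles from \<open>i\<close> either pass through \<open>j\<close> or leave it to the
  complement, which is then expanded at \<open>j\<close>. The first kind is symmetric by rotation,
  the second as a sum over two disjoint cycles.\<close>

lemma cycle_expansion_independent: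
  assumes "i \<in> \<alpha>" "j \<in> \<alpha>"
    and exp: "\<And>\<beta> k. \<beta> \<subset> \<alpha> \<Longrightarrow> k \<in> \<beta> \<Longrightarrow> qre (qdet M \<beta>) = cycle_expansion M k \<beta>"
  shows "cycle_expansion M i \<alpha> = cycle_expansion M j \<alpha>"
proof (cases "i = j")
  case False
  define d where "d \<beta> = qre (qdet M \<beta>)" for \<beta>
  define c where "c k L = (- 1) ^ length L * qre (walk M k (L @ [k]))" for k L
  define F where "F i j = (\<Sum>(A, B)\<in>path_pairs i j \<alpha>. c i (A @ j # B) * d (\<alpha> - set (i # A @ j # B)))" for i j
  define G where "G i j = (\<Sum>(A, B)\<in>path_pairs i j \<alpha>. c i A * (c j B * d (\<alpha> - set (i # A @ j # B))))" for i j
  have split: "cycle_expansion M k \<alpha> = F k l + G k l" if "k \<noteq> l" "k \<in> \<alpha>" "l \<in> \<alpha>" for k l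
  proof -
    have "d (\<alpha> - set (k # A)) = (\<Sum>B\<in>paths l (\<alpha> - set (k # A)). c l B * d (\<alpha> - set (k # A @ l # B)))"
      if "A \<in> paths k \<alpha>" "l \<notin> set A" for A
    proof -
      have "\<alpha> - set (k # A) - set (l # B) = \<alpha> - set (k # A @ l # B)" for B
        by auto
      then show ?thesis
        using exp[of "\<alpha> - set (k # A)" l] that \<open>k \<noteq> l\<close> \<open>k \<in> \<alpha>\<close> \<open>l \<in> \<alpha>\<close>
        unfolding cycle_expansion_def d_def c_def by auto
    qed
    then have "G k l = (\<Sum>L | L \<in> paths k \<alpha> \<and> l \<notin> set L. c k L * d (\<alpha> - set (k # L)))"
      unfolding G_def sum_path_pairs_disjoint[OF that(1)]
      by (intro sum.cong) (simp_all add: sum_distrib_left)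
    then show ?thesis
      unfolding cycle_expansion_def F_def c_def[symmetric] d_def[symmetric]
      by (subst sum_paths_split[OF that(1,3)]) simp
  qed
  have rot: "qre (walk M i (A @ j # B @ [i])) = qre (walk M j (B @ i # A @ [j]))" for A B
    by (subst (1 2) walk_append) (rule qre_mult_commute)
  have "F i j = F j i"
    unfolding F_def by (subst sum_path_pairs_swap) (auto simp: c_def rot insert_commute Un_commute add.commute intro!: sum.cong)
  moreover have "G i j = G j i"
    unfolding G_def by (subst sum_path_pairs_swap) (auto simp: insert_commute Un_commute algebra_simps intro!: sum.cong)
  ultimately show ?thesis
    using split[OF False assms(1,2)] split[of j i] False assms(1,2) by simp
qed simp

text \<open>Realness and independence of the index are proved together by induction: both rest on
  the proper subsets that remain after removing a cycle.\<close>

theorem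
  assumes herm: "hermitian M"
  shows rdet_hermitian: "i \<in> \<alpha> \<Longrightarrow> rdet i M \<alpha> = qdet M \<alpha>"
    and qdet_hermitian_real: "of_real (qre (qdet M \<alpha>)) = qdet M \<alpha>"
proof -
  have "of_real (qre (qdet M \<alpha>)) = qdet M \<alpha> \<and> (\<forall>i\<in>\<alpha>. rdet i M \<alpha> = qdet M \<alpha>) \<and>
    (\<forall>i\<in>\<alpha>. qre (qdet M \<alpha>) = cycle_expansion M i \<alpha>)"
  proof (induction "card \<alpha>" arbitrary: \<alpha> rule: less_induct)
    case less
    have IH: "of_real (qre (qdet M \<beta>)) = qdet M \<beta>"
      "k \<in> \<beta> \<Longrightarrow> qre (qdet M \<beta>) = cycle_expansion M k \<beta>" if "\<beta> \<subset> \<alpha>" for \<beta> k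
      using less[OF psubset_card_mono[OF finite that]] by auto
    have r: "rdet i M \<alpha> = of_real (cycle_expansion M i \<alpha>)" if "i \<in> \<alpha>" for i
      using rdet_eq_cycle_expansion[OF herm that IH(1)] .
    have e: "cycle_expansion M i \<alpha> = cycle_expansion M j \<alpha>" if "i \<in> \<alpha>" "j \<in> \<alpha>" for i j
      using cycle_expansion_independent[OF that IH(2)] .
    show ?case
    proof (cases "\<alpha> = {}")
      case False
      then have "Min \<alpha> \<in> \<alpha>" by simp
      then show ?thesis
        using r e qdet_eq_rdet[OF False, of M] by (metis quat_of_real_sel(1))
    qed simp
  qed
  then show "i \<in> \<alpha> \<Longrightarrow> rdet i M \<alpha> = qdet M \<alpha>" and "of_real (qre (qdet M \<alpha>)) = qdet M \<alpha>"
    by auto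
qed

section \<open>Replacing one row\<close>

lemma qdet_cong:
  assumes "\<And>q. q \<in> \<gamma> \<Longrightarrow> M $ q = N $ q"
  shows "qdet M \<gamma> = qdet N \<gamma>"
proof -
  have "cycle_prod M \<tau> p = cycle_prod N \<tau> p" if \<tau>: "\<tau> permutes \<gamma>" "p \<in> \<gamma>" for \<tau> p
  proof -
    have "set (support \<tau> p) \<subseteq> \<gamma>"
      using support_cong_on(2)[of \<gamma> \<tau> \<tau> p] permutes_in_image[OF \<tau>(1)] \<tau>(2) by blast
    then have "map (\<lambda>q. M $ q $ \<tau> q) (support \<tau> p) = map (\<lambda>q. N $ q $ \<tau> q) (support \<tau> p)"
      by (intro map_cong[OF refl]) (metis assms subsetD)
    then show ?thesis unfolding cycle_prod_def by (rule arg_cong)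
  qed
  then have "map (cycle_prod M \<tau>) (leaders \<gamma> \<tau>) = map (cycle_prod N \<tau>) (leaders \<gamma> \<tau>)" if "\<tau> permutes \<gamma>" for \<tau>
    using that by (intro map_cong) (auto simp: leaders_def)
  then show ?thesis
    unfolding qdet_def by (intro sum.cong refl) (simp only: mem_Collect_eq)
qed

text \<open>A closed walk leaves \<open>j\<close> only in its first step, and the complement avoids
  \<open>j\<close>. So \<open>b\<close> enters each summand once, as the first factor of the walk;
  \<open>hd\<close> and \<open>tl\<close> cover the fixed point \<open>L = []\<close>.\<close>

lemma rdet_replace_row:
  assumes "j \<in> \<alpha>"
  shows "rdet j (replace_row M j b) \<alpha> = (\<Sum>L\<in>paths j \<alpha>. (- 1) ^ length L *
    (b $ hd (L @ [j]) * walk M (hd (L @ [j])) (tl (L @ [j]))) * qdet M (\<alpha> - set (j # L)))"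
proof -
  have "walk (replace_row M j b) j (L @ [j]) = b $ hd (L @ [j]) * walk M (hd (L @ [j])) (tl (L @ [j]))"
    if "L \<in> paths j \<alpha>" for L
  proof (cases L)
    case (Cons x xs)
    have "walk (replace_row M j b) x (xs @ [j]) = walk M x (xs @ [j])"
      using that Cons by (intro walk_cong) (auto simp: replace_row_def vec_eq_iff paths_def)
    then show ?thesis by (simp add: Cons) (simp add: replace_row_def)
  qed (simp add: replace_row_def)
  moreover have "qdet (replace_row M j b) (\<alpha> - set (j # L)) = qdet M (\<alpha> - set (j # L))" for L
    by (rule qdet_cong) (auto simp: replace_row_def vec_eq_iff)
  ultimately show ?thesis
    unfolding rdet_eq_sum_paths[OF assms] by (intro sum.cong) simp_all
qed

lemma rdet_replace_row_row:
  assumes "j \<in> \<alpha>"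
  shows "rdet j (replace_row M j (row i M)) \<alpha> =
    (\<Sum>L\<in>paths j \<alpha>. (- 1) ^ length L * walk M i (L @ [j]) * qdet M (\<alpha> - set (j # L)))"
proof -
  have "row i M $ hd (L @ [j]) * walk M (hd (L @ [j])) (tl (L @ [j])) = walk M i (L @ [j])" for L
    by (cases L) (simp_all add: row_def)
  then show ?thesis
    unfolding rdet_replace_row[OF assms] by simp
qed

text \<open>
  The cycles of \<open>j\<close> through \<open>i\<close> cancel against the others: deleting from \<open>(j A i B)\<close> the part \<open>(i A)\<close>,
  a closed walk at \<open>i\<close>, leaves \<open>(j B)\<close>, and the closed walks \<open>A\<close> sum to the determinant of the complement
  of \<open>(j B)\<close>, which is real and so may be moved to the right.
\<close>

theorem rdet_hermitian_equal_rows: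
  assumes herm: "hermitian M" and "i \<in> \<alpha>" "j \<in> \<alpha>" "i \<noteq> j"
  shows "rdet j (replace_row M j (row i M)) \<alpha> = 0"
proof -
  let ?D = "\<lambda>\<beta>. qdet M \<beta>"
  define d where "d \<beta> = qre (qdet M \<beta>)" for \<beta>
  have D: "qdet M \<beta> = of_real (d \<beta>)" for \<beta>
    unfolding d_def by (rule qdet_hermitian_real[OF herm, symmetric])
  have "(\<Sum>(A, B)\<in>path_pairs j i \<alpha>. (- 1) ^ length (A @ i # B) * walk M i ((A @ i # B) @ [j]) *
      ?D (\<alpha> - set (j # A @ i # B))) =
    (\<Sum>(B, A)\<in>path_pairs j i \<alpha>. (- 1) ^ length (A @ i # B) * walk M i ((A @ i # B) @ [j]) *
      ?D (\<alpha> - set (j # A @ i # B)))"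
    by (rule sum_path_pairs_swap')
  also have "\<dots> = (\<Sum>B | B \<in> paths j \<alpha> \<and> i \<notin> set B. \<Sum>A\<in>paths i (\<alpha> - set (j # B)).
      (- 1) ^ length (A @ i # B) * walk M i ((A @ i # B) @ [j]) * ?D (\<alpha> - set (j # A @ i # B)))"
    by (rule sum_path_pairs_disjoint) (use assms in auto)
  also have "\<dots> = (\<Sum>B | B \<in> paths j \<alpha> \<and> i \<notin> set B.
      - ((- 1) ^ length B * walk M i (B @ [j]) * ?D (\<alpha> - set (j # B))))"
  proof (rule sum.cong[OF refl])
    fix B assume B: "B \<in> {B \<in> paths j \<alpha>. i \<notin> set B}"
    have "?D (\<alpha> - set (j # B)) = rdet i M (\<alpha> - set (j # B))"
      using assms B by (intro rdet_hermitian[OF herm, symmetric]) auto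
    also have "\<dots> = (\<Sum>A\<in>paths i (\<alpha> - set (j # B)).
        (- 1) ^ length A * walk M i (A @ [i]) * ?D (\<alpha> - set (j # B) - set (i # A)))"
      using assms B by (intro rdet_eq_sum_paths) auto
    finally have eq: "?D (\<alpha> - set (j # B)) = \<dots>" .
    have "\<alpha> - set (j # B) - set (i # A) = \<alpha> - set (j # A @ i # B)" for A
      by auto
    then have eq': "?D (\<alpha> - set (j # B)) = (\<Sum>A\<in>paths i (\<alpha> - set (j # B)).
        (- 1) ^ length A * walk M i (A @ [i]) * ?D (\<alpha> - set (j # A @ i # B)))"
      unfolding eq by (simp only:)
    have wa: "walk M i ((A @ i # B) @ [j]) = walk M i (A @ [i]) * walk M i (B @ [j])" for A
      using walk_append[of M i A i "B @ [j]"] by (simp only: append_assoc append_Cons)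
    have "(- 1) ^ length B * walk M i (B @ [j]) * ?D (\<alpha> - set (j # B)) =
        ?D (\<alpha> - set (j # B)) * ((- 1) ^ length B * walk M i (B @ [j]))"
      unfolding D by (rule quat_of_real_commute[symmetric])
    also have "\<dots> = (\<Sum>A\<in>paths i (\<alpha> - set (j # B)).
        (- 1) ^ length A * walk M i (A @ [i]) * ?D (\<alpha> - set (j # A @ i # B)) *
        ((- 1) ^ length B * walk M i (B @ [j])))"
      unfolding eq' by (rule sum_distrib_right)
    \<comment> \<open>Joining the two cycles adds the entry \<open>i\<close> to the list, which
      changes the sign.\<close>
    also have "\<dots> = (\<Sum>A\<in>paths i (\<alpha> - set (j # B)). - ((- 1) ^ length (A @ i # B) *
        walk M i ((A @ i # B) @ [j]) * ?D (\<alpha> - set (j # A @ i # B))))"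
      unfolding wa D by (simp add: minus_one_power_mult_quat quat_mult_of_real power_add mult_ac)
    finally show "(\<Sum>A\<in>paths i (\<alpha> - set (j # B)). (- 1) ^ length (A @ i # B) *
        walk M i ((A @ i # B) @ [j]) * ?D (\<alpha> - set (j # A @ i # B))) =
        - ((- 1) ^ length B * walk M i (B @ [j]) * ?D (\<alpha> - set (j # B)))"
      by (simp only: sum_negf minus_minus)
  qed
  finally show ?thesis
    unfolding rdet_replace_row_row[OF assms(3)]
    using assms by (subst sum_paths_split[of j i]) (simp_all add: sum_negf)
qed

section \<open>Column determinants through inverse permutations\<close>

lemma support_eqI:
  assumes "distinct (p # L)" "map \<sigma> (p # L) = L @ [p]"
  shows "support \<sigma> p = p # L"
proof -
  let ?cs = "p # L"
  have "map (cycle_of_list ?cs) ?cs = map (cycle_of_list ?cs ^^ 1) ?cs"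
    by (simp only: One_nat_def funpow.simps comp_id)
  also have "\<dots> = map \<sigma> ?cs"
    unfolding cyclic_rotation[OF assms(1)] assms(2) by simp
  finally have "\<forall>x\<in>set ?cs. \<sigma> x = cycle_of_list ?cs x \<and> cycle_of_list ?cs x \<in> set ?cs"
    by (metis cycle_of_list_in map_eq_conv)
  from support_cong_on(1)[OF this, of p] show ?thesis
    using support_cycle_of_list[OF assms(1)] by simp
qed

lemma support_cycle:
  assumes "permutation \<sigma>"
  obtains L where "support \<sigma> p = p # L" "distinct (p # L)" "map \<sigma> (p # L) = L @ [p]"
proof -
  have s: "support \<sigma> p = p # tl (support \<sigma> p)"
    using least_power_of_permutation(2)[OF assms, of p] by (cases "least_power \<sigma> p") (simp_all add: upt_conv_Cons del: upt_Suc)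
  have d: "distinct (support \<sigma> p)"
    by (rule cycle_of_permutation[OF assms])
  have "map \<sigma> (support \<sigma> p) = map (cycle_of_list (support \<sigma> p) ^^ 1) (support \<sigma> p)"
    by (rule map_cong[OF refl]) (simp only: cycle_restrict[OF assms] One_nat_def funpow.simps comp_id)
  also have "\<dots> = rotate 1 (support \<sigma> p)"
    by (rule cyclic_rotation[OF d])
  finally have m: "map \<sigma> (support \<sigma> p) = rotate1 (support \<sigma> p)"
    by simp
  obtain L where L: "support \<sigma> p = p # L"
    by (rule that[OF s])
  have "map \<sigma> (p # L) = L @ [p]" "distinct (p # L)"
    using m d unfolding L by simp_all
  then show thesis
    by (intro that[OF L])
qed

text \<open>The inverse runs through each cycle backwards from the same start; conjugation restores
  the order of the factors.\<close>

lemma support_inv: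
  assumes \<sigma>: "permutation \<sigma>"
  shows "set (support (inv \<sigma>) p) = set (support \<sigma> p)"
    and "cycle_prod M (inv \<sigma>) p = qcnj (cycle_prod (M\<^sup>H) \<sigma> p)"
proof -
  obtain L where L: "support \<sigma> p = p # L" "distinct (p # L)" "map \<sigma> (p # L) = L @ [p]"
    using support_cycle[OF \<sigma>] by blast
  have "map (inv \<sigma>) (map \<sigma> (p # L)) = p # L"
    using permutation_bijective[OF \<sigma>] by (simp add: bij_is_inj)
  then have "rev (map (inv \<sigma>) (L @ [p])) = rev (p # L)"
    unfolding L(3) by simp
  then have m: "map (inv \<sigma>) (p # rev L) = rev L @ [p]"
    by (simp add: rev_map)
  have s: "support (inv \<sigma>) p = p # rev L"
    using L(2) m by (intro support_eqI) simp_all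
  show "set (support (inv \<sigma>) p) = set (support \<sigma> p)"
    unfolding s L(1) by simp
  show "cycle_prod M (inv \<sigma>) p = qcnj (cycle_prod (M\<^sup>H) \<sigma> p)"
    unfolding cycle_prod_def s L(1) prod_list_eq_walk[OF m] prod_list_eq_walk[OF L(3)] qcnj_walk
    by simp
qed

text \<open>Passing to inverse permutations keeps the cycle starts and reverses every cycle;
  conjugation reverses all products. Column statements thus reduce to row statements.\<close>

theorem cdet_eq_qcnj_rdet: "cdet j M \<alpha> = qcnj (rdet j (M\<^sup>H) \<alpha>)"
proof -
  let ?f = "\<lambda>\<tau>. (- 1) ^ (card \<alpha> - length (cycle_starts \<alpha> \<tau> j)) *
     prod_list (map (cycle_prod M \<tau>) (rev (cycle_starts \<alpha> \<tau> j)))"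
  have "cdet j M \<alpha> = (\<Sum>\<tau> | \<tau> permutes \<alpha>. ?f (inv \<tau>))"
    unfolding cdet_def by (rule sum_permutations_inverse)
  also have "\<dots> = (\<Sum>\<sigma> | \<sigma> permutes \<alpha>. qcnj ((- 1) ^ (card \<alpha> - length (cycle_starts \<alpha> \<sigma> j)) *
     prod_list (map (cycle_prod (M\<^sup>H) \<sigma>) (cycle_starts \<alpha> \<sigma> j))))"
  proof (rule sum.cong[OF refl])
    fix \<sigma> assume "\<sigma> \<in> {\<sigma>. \<sigma> permutes \<alpha>}"
    then have pm: "permutation \<sigma>" using finite permutation_permutes by blast
    have cs: "cycle_starts \<alpha> (inv \<sigma>) j = cycle_starts \<alpha> \<sigma> j"
      unfolding cycle_starts_def support_inv(1)[OF pm] ..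
    have cp: "cycle_prod M (inv \<sigma>) = qcnj \<circ> cycle_prod (M\<^sup>H) \<sigma>"
      using support_inv(2)[OF pm] by auto
    show "?f (inv \<sigma>) = qcnj ((- 1) ^ (card \<alpha> - length (cycle_starts \<alpha> \<sigma> j)) *
        prod_list (map (cycle_prod (M\<^sup>H) \<sigma>) (cycle_starts \<alpha> \<sigma> j)))"
      unfolding cs cp by (simp add: qcnj_prod_list rev_map minus_one_power_mult_quat power_commuting_commutes)
  qed
  finally show ?thesis
    unfolding rdet_def qcnj_sum .
qed

text \<open>A member of \<open>\<alpha>\<close> pins down the number described by
  \<open>THE\<close>; for empty \<open>\<alpha>\<close> every real number would satisfy the
  condition.\<close>

lemma hdet_eq_qdet:
  assumes herm: "hermitian M" and "\<alpha> \<noteq> {}"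
  shows "hdet M \<alpha> = qre (qdet M \<alpha>)"
proof -
  have "M\<^sup>H = M" using herm by (simp add: hermitian_def)
  then have *: "rdet i M \<alpha> = of_real (qre (qdet M \<alpha>))" "cdet i M \<alpha> = of_real (qre (qdet M \<alpha>))" if "i \<in> \<alpha>" for i
    by (simp_all only: cdet_eq_qcnj_rdet rdet_hermitian[OF herm that] qdet_hermitian_real[OF herm])
      (metis qcnj_of_real qdet_hermitian_real[OF herm])
  show ?thesis
    unfolding hdet_def
  proof (rule the_equality)
    fix d assume d: "\<forall>i\<in>\<alpha>. rdet i M \<alpha> = of_real d \<and> cdet i M \<alpha> = of_real d"
    then show "d = qre (qdet M \<alpha>)"
      using assms(2) *(1) by (metis all_not_in_conv quat_of_real_sel(1))
  qed (use * in blast)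
qed

section \<open>The Faddeev--LeVerrier recursion for row determinants\<close>

text \<open>Based on \<open>qdet\<close> rather than \<open>hdet\<close>, so that the value at
  \<open>k = 0\<close> is 1, where the recursion starts.\<close>

definition pminor_sum :: "('n::{finite,linorder}) qmat \<Rightarrow> nat \<Rightarrow> real" where
  "pminor_sum M k = (\<Sum>\<alpha>\<in>index_sets k. qre (qdet M \<alpha>))"

text \<open>Row \<open>p\<close> is the image of the \<open>p\<close>-th unit row, so the map acts
  on rows by multiplication from the right. These matrices play the part of the coefficients of the
  adjugate of \<open>x I + M\<close>.\<close>

definition rdet_mat :: "('n::{finite,linorder}) qmat \<Rightarrow> nat \<Rightarrow> 'n qmat" where
  "rdet_mat M k = (\<chi> p j. rdet_sum k j M (axis p 1))"

lemma minor_sum_eq_pminor_sum: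
  assumes "hermitian M" "k \<ge> 1"
  shows "minor_sum k M = pminor_sum M k"
  unfolding minor_sum_def pminor_sum_def
  by (rule sum.cong[OF refl], rule hdet_eq_qdet[OF assms(1)]) (use assms(2) in \<open>auto simp: index_sets_def\<close>)

text \<open>By \<open>rdet_replace_row\<close> the entry of \<open>b\<close> is the leftmost factor
  apart from the sign, so the sum is left linear in \<open>b\<close>.\<close>

lemma rdet_sum_eq: "rdet_sum k j M b = (\<Sum>p\<in>UNIV. b $ p * rdet_mat M k $ p $ j)"
proof -
  have "rdet j (replace_row M j b) \<alpha> = (\<Sum>p\<in>UNIV. b $ p * rdet j (replace_row M j (axis p 1)) \<alpha>)"
    if "j \<in> \<alpha>" for \<alpha>
  proof -
    have "(\<Sum>p\<in>UNIV. b $ p * ((- 1) ^ n * (axis p 1 $ h * w) * D)) = (- 1) ^ n * (b $ h * w) * D" for n h w D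
    proof -
      have "(\<Sum>p\<in>UNIV. b $ p * ((- 1) ^ n * (axis p 1 $ h * w) * D)) =
        (\<Sum>p\<in>UNIV. if p = h then (- 1) ^ n * (b $ h * w) * D else 0)"
        by (rule sum.cong) (auto simp: axis_def minus_one_power_mult_quat mult.assoc)
      then show ?thesis by simp
    qed
    then show ?thesis
      unfolding rdet_replace_row[OF that] sum_distrib_left by (subst sum.swap) simp
  qed
  then have "rdet_sum k j M b = (\<Sum>\<alpha>\<in>index_sets_at k j. \<Sum>p\<in>UNIV. b $ p * rdet j (replace_row M j (axis p 1)) \<alpha>)"
    unfolding rdet_sum_def by (intro sum.cong) (auto simp: index_sets_at_def)
  also have "\<dots> = (\<Sum>p\<in>UNIV. \<Sum>\<alpha>\<in>index_sets_at k j. b $ p * rdet j (replace_row M j (axis p 1)) \<alpha>)"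
    by (rule sum.swap)
  finally show ?thesis
    by (simp add: rdet_mat_def rdet_sum_def sum_distrib_left)
qed

lemma rdet_sum_row: "rdet_sum k j M (row t Y) = (Y ** rdet_mat M k) $ t $ j"
  unfolding rdet_sum_eq by (simp add: matrix_matrix_mult_def row_def)

lemma cdet_sum_column: "cdet_sum k i M (column t Y) = ((rdet_mat (M\<^sup>H) k)\<^sup>H ** Y) $ i $ t"
proof -
  have "(replace_col M i (column t Y))\<^sup>H = replace_row (M\<^sup>H) i (row t (Y\<^sup>H))"
    by (simp add: vec_eq_iff replace_col_def replace_row_def row_def column_def)
  then have "cdet_sum k i M (column t Y) = qcnj (rdet_sum k i (M\<^sup>H) (row t (Y\<^sup>H)))"
    unfolding cdet_sum_def rdet_sum_def cdet_eq_qcnj_rdet qcnj_sum by simp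
  then show ?thesis
    unfolding rdet_sum_row by (simp add: matrix_matrix_mult_def qcnj_sum)
qed

text \<open>Only paths that step to \<open>i\<close> first survive. Dropping this \<open>i\<close>
  leaves a path in \<open>\<beta> - {i}\<close> that is shorter by one, hence the sign.\<close>

lemma rdet_axis_other:
  assumes "i \<noteq> j" "j \<in> \<beta>"
  shows "rdet j (replace_row M j (axis i 1)) \<beta> = (if i \<in> \<beta> then
    - (\<Sum>L\<in>paths j (\<beta> - {i}). (- 1) ^ length L * walk M i (L @ [j]) * qdet M (\<beta> - {i} - set (j # L))) else 0)"
proof -
  let ?f = "\<lambda>L. (- 1) ^ length L * (axis i 1 $ hd (L @ [j]) * walk M (hd (L @ [j])) (tl (L @ [j]))) * qdet M (\<beta> - set (j # L))"
  have hd: "hd (L @ [j]) \<in> \<beta>" if "L \<in> paths j \<beta>" for L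
    using that assms(2) by (cases L) (auto simp: paths_def)
  show ?thesis
  proof (cases "i \<in> \<beta>")
    case False
    have "(\<Sum>L\<in>paths j \<beta>. ?f L) = 0"
    proof (rule sum.neutral, rule ballI)
      fix L assume "L \<in> paths j \<beta>"
      then show "?f L = 0"
        using hd[of L] False by (auto simp: axis_def)
    qed
    then show ?thesis
      unfolding rdet_replace_row[OF assms(2)] using False by (simp only: if_False)
  next
    case True
    have sub: "Cons i ` paths j (\<beta> - {i}) \<subseteq> paths j \<beta>"
      using True assms by (auto simp: paths_def)
    have "(\<Sum>L\<in>paths j \<beta>. ?f L) = (\<Sum>L\<in>Cons i ` paths j (\<beta> - {i}). ?f L)"
    proof (rule sum.mono_neutral_right[OF _ sub], simp, rule ballI)
      fix L assume L: "L \<in> paths j \<beta> - Cons i ` paths j (\<beta> - {i})"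
      have "hd (L @ [j]) \<noteq> i"
        using L assms(1) by (cases L) (auto simp: paths_def image_iff)
      then show "?f L = 0" by (simp add: axis_def)
    qed
    also have "\<dots> = (\<Sum>L\<in>paths j (\<beta> - {i}). ?f (i # L))"
      by (subst sum.reindex) auto
    also have "\<dots> = (\<Sum>L\<in>paths j (\<beta> - {i}). - ((- 1) ^ length L * walk M i (L @ [j]) * qdet M (\<beta> - {i} - set (j # L))))"
    proof (rule sum.cong[OF refl])
      fix L
      have "\<beta> - set (j # i # L) = \<beta> - {i} - set (j # L)" by auto
      then show "?f (i # L) = - ((- 1) ^ length L * walk M i (L @ [j]) * qdet M (\<beta> - {i} - set (j # L)))"
        by simp
    qed
    finally show ?thesis
      unfolding rdet_replace_row[OF assms(2)] using True by (simp add: sum_negf)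
  qed
qed

text \<open>Only the empty path survives, where \<open>j\<close> is a fixed point.\<close>

lemma rdet_axis_self:
  assumes "j \<in> \<beta>"
  shows "rdet j (replace_row M j (axis j 1)) \<beta> = qdet M (\<beta> - {j})"
proof -
  let ?f = "\<lambda>L. (- 1) ^ length L * (axis j 1 $ hd (L @ [j]) * walk M (hd (L @ [j])) (tl (L @ [j]))) * qdet M (\<beta> - set (j # L))"
  have nil: "[] \<in> paths j \<beta>"
    by (simp add: paths_def)
  have "(\<Sum>L\<in>paths j \<beta>. ?f L) = (\<Sum>L\<in>{[]}. ?f L)"
  proof (rule sum.mono_neutral_right)
    show "\<forall>L\<in>paths j \<beta> - {[]}. ?f L = 0"
    proof
      fix L assume "L \<in> paths j \<beta> - {[]}"
      then have "hd (L @ [j]) \<noteq> j" by (cases L) (auto simp: paths_def)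
      then show "?f L = 0" by (simp add: axis_def)
    qed
  qed (auto simp: nil)
  then show ?thesis
    unfolding rdet_replace_row[OF assms] by simp
qed

lemma sum_index_sets_remove:
  fixes f :: "('n::finite) set \<Rightarrow> 'a::comm_monoid_add"
  shows "(\<Sum>\<beta> | \<beta> \<in> index_sets (Suc k) \<and> i \<in> \<beta> \<and> P (\<beta> - {i}). f (\<beta> - {i})) =
    (\<Sum>\<alpha> | \<alpha> \<in> index_sets k \<and> i \<notin> \<alpha> \<and> P \<alpha>. f \<alpha>)"
  by (rule sum.reindex_bij_witness[where i = "insert i" and j = "\<lambda>\<beta>. \<beta> - {i}"])
    (auto simp: index_sets_def insert_absorb)

text \<open>On the diagonal the product collects the sets that contain \<open>j\<close>, the second
  matrix those that do not. Off the diagonal, sets containing both indices vanish by equal rows, and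
  those with \<open>j\<close> alone cancel against sets enlarged by \<open>i\<close>.\<close>

theorem faddeev_leverrier:
  assumes herm: "hermitian M"
  shows "M ** rdet_mat M k + rdet_mat M (Suc k) = mat (of_real (pminor_sum M k))"
proof -
  have "rdet_sum k j M (row i M) + rdet_sum (Suc k) j M (axis i 1) = (if i = j then of_real (pminor_sum M k) else 0)" for i j
  proof (cases "i = j")
    case True
    have "replace_row M j (row j M) = M"
      by (simp add: vec_eq_iff replace_row_def row_def)
    then have 1: "rdet_sum k j M (row j M) = (\<Sum>\<alpha>\<in>{\<alpha> \<in> index_sets k. j \<in> \<alpha>}. qdet M \<alpha>)"
      unfolding rdet_sum_def index_sets_at_def using rdet_hermitian[OF herm] by (intro sum.cong) auto
    have "rdet_sum (Suc k) j M (axis j 1) = (\<Sum>\<beta> | \<beta> \<in> index_sets (Suc k) \<and> j \<in> \<beta> \<and> True. qdet M (\<beta> - {j}))"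
      unfolding rdet_sum_def index_sets_at_def by (intro sum.cong) (auto simp: rdet_axis_self)
    also have "\<dots> = (\<Sum>\<alpha> | \<alpha> \<in> index_sets k \<and> j \<notin> \<alpha> \<and> True. qdet M \<alpha>)"
      by (rule sum_index_sets_remove)
    finally have 2: "rdet_sum (Suc k) j M (axis j 1) = (\<Sum>\<alpha>\<in>{\<alpha> \<in> index_sets k. j \<notin> \<alpha>}. qdet M \<alpha>)"
      by simp
    have "rdet_sum k j M (row j M) + rdet_sum (Suc k) j M (axis j 1) =
      (\<Sum>\<alpha>\<in>{\<alpha> \<in> index_sets k. j \<in> \<alpha>} \<union> {\<alpha> \<in> index_sets k. j \<notin> \<alpha>}. qdet M \<alpha>)"
      unfolding 1 2 by (rule sum.union_disjoint[symmetric]) auto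
    also have "\<dots> = (\<Sum>\<alpha>\<in>index_sets k. of_real (qre (qdet M \<alpha>)))"
      by (rule sum.cong) (auto simp: qdet_hermitian_real[OF herm])
    finally show ?thesis
      using True by (simp add: pminor_sum_def)
  next
    case False
    define g where "g \<alpha> = (\<Sum>L\<in>paths j \<alpha>. (- 1) ^ length L * walk M i (L @ [j]) * qdet M (\<alpha> - set (j # L)))" for \<alpha>
    have "rdet_sum k j M (row i M) = (\<Sum>\<alpha> | \<alpha> \<in> index_sets k \<and> i \<notin> \<alpha> \<and> j \<in> \<alpha>. g \<alpha>)"
      unfolding rdet_sum_def
    proof (rule sum.mono_neutral_cong_right)
      show "\<forall>\<alpha>\<in>index_sets_at k j - {\<alpha> \<in> index_sets k. i \<notin> \<alpha> \<and> j \<in> \<alpha>}. rdet j (replace_row M j (row i M)) \<alpha> = 0"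
        using False by (auto simp: index_sets_at_def intro!: rdet_hermitian_equal_rows[OF herm])
    qed (auto simp: index_sets_at_def g_def rdet_replace_row_row)
    moreover have "rdet_sum (Suc k) j M (axis i 1) =
      (\<Sum>\<beta> | \<beta> \<in> index_sets (Suc k) \<and> i \<in> \<beta> \<and> j \<in> \<beta> - {i}. - g (\<beta> - {i}))"
      unfolding rdet_sum_def
      by (rule sum.mono_neutral_cong_right) (use False in \<open>auto simp: index_sets_at_def g_def rdet_axis_other simp del: list.set\<close>)
    moreover have "\<dots> = (\<Sum>\<alpha> | \<alpha> \<in> index_sets k \<and> i \<notin> \<alpha> \<and> j \<in> \<alpha>. - g \<alpha>)"
      by (rule sum_index_sets_remove)
    ultimately show ?thesis
      using False by (simp only: sum_negf) simp
  qed
  then show ?thesis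
    by (simp add: vec_eq_iff rdet_sum_row[symmetric] mat_def) (simp add: rdet_mat_def)
qed

section \<open>Boundary values of the recursion and its trace\<close>

lemma index_sets_0: "index_sets 0 = {{} :: 'n::finite set}"
  by (auto simp: index_sets_def)

lemma index_sets_eq_empty: "CARD('n) < k \<Longrightarrow> index_sets k = ({} :: 'n::finite set set)"
proof (rule ccontr)
  assume k: "CARD('n) < k" and "index_sets k \<noteq> ({} :: 'n set set)"
  then obtain \<alpha> :: "'n set" where "card \<alpha> = k"
    by (auto simp: index_sets_def)
  then show False
    using k card_mono[of UNIV \<alpha>] by simp
qed

lemma pminor_sum_0 [simp]: "pminor_sum M 0 = 1"
  by (simp add: pminor_sum_def index_sets_0)

lemma pminor_sum_eq_0: "CARD('n) < k \<Longrightarrow> pminor_sum (M :: 'n::{finite,linorder} qmat) k = 0"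
  by (simp add: pminor_sum_def index_sets_eq_empty)

lemma rdet_mat_0 [simp]: "rdet_mat (M :: 'n::{finite,linorder} qmat) 0 = 0"
proof -
  have "index_sets_at 0 j = {}" for j :: 'n
    by (auto simp: index_sets_at_def index_sets_0)
  then show ?thesis
    by (simp add: rdet_mat_def rdet_sum_def vec_eq_iff)
qed

lemma rdet_mat_eq_0: "CARD('n) < k \<Longrightarrow> rdet_mat (M :: 'n::{finite,linorder} qmat) k = 0"
  by (simp add: rdet_mat_def rdet_sum_def index_sets_at_def index_sets_eq_empty vec_eq_iff)

definition rtr :: "'n::finite qmat \<Rightarrow> real" where
  "rtr A = (\<Sum>i\<in>UNIV. qre (A $ i $ i))"

text \<open>Each principal minor of size \<open>k\<close> occurs once for each of its
  \<open>k\<close> indices.\<close>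

lemma rtr_rdet_mat:
  assumes herm: "hermitian M"
  shows "rtr (M ** rdet_mat M k) = real k * pminor_sum M k"
proof -
  have r: "replace_row M j (row j M) = M" for j
    by (simp add: vec_eq_iff replace_row_def row_def)
  have "rtr (M ** rdet_mat M k) = (\<Sum>j\<in>UNIV. qre (rdet_sum k j M (row j M)))"
    by (simp add: rtr_def rdet_sum_row)
  also have "\<dots> = (\<Sum>j\<in>UNIV. \<Sum>\<alpha>\<in>index_sets k. if j \<in> \<alpha> then qre (qdet M \<alpha>) else 0)"
  proof (rule sum.cong[OF refl])
    fix j
    show "qre (rdet_sum k j M (row j M)) = (\<Sum>\<alpha>\<in>index_sets k. if j \<in> \<alpha> then qre (qdet M \<alpha>) else 0)"
      unfolding rdet_sum_def qre_sum index_sets_at_def r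
      by (subst sum.inter_filter[symmetric]) (auto intro!: sum.cong simp: rdet_hermitian[OF herm])
  qed
  also have "\<dots> = (\<Sum>\<alpha>\<in>index_sets k. \<Sum>j\<in>UNIV. if j \<in> \<alpha> then qre (qdet M \<alpha>) else 0)"
    by (rule sum.swap)
  also have "\<dots> = (\<Sum>\<alpha>\<in>index_sets k. real k * qre (qdet M \<alpha>))"
    by (rule sum.cong[OF refl]) (simp add: sum.If_cases index_sets_def)
  finally show ?thesis
    by (simp add: pminor_sum_def sum_distrib_left)
qed

section \<open>Matrix algebra over the quaternions\<close>

lemma matrix_scaleR_left [simp]: "(r *\<^sub>R A) ** B = r *\<^sub>R (A ** (B :: quat^'n::finite^'k::finite))"
  by (simp add: vec_eq_iff matrix_matrix_mult_def scaleR_right.sum)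

lemma matrix_scaleR_right [simp]: "A ** (r *\<^sub>R B) = r *\<^sub>R (A ** (B :: quat^'n::finite^'k::finite))"
  by (simp add: vec_eq_iff matrix_matrix_mult_def scaleR_right.sum)

lemma matrix_diff_ldistrib: "A ** (B - C) = A ** B - A ** (C :: quat^'n::finite^'k::finite)"
  by (simp add: vec_eq_iff matrix_matrix_mult_def right_diff_distrib sum_subtractf)

lemma matrix_diff_rdistrib: "(B - C) ** A = B ** A - C ** (A :: quat^'n::finite^'k::finite)"
  by (simp add: vec_eq_iff matrix_matrix_mult_def left_diff_distrib sum_subtractf)

lemma matrix_zero_right [simp]: "A ** (0 :: quat^'n::finite^'k::finite) = 0"
  by (simp add: vec_eq_iff matrix_matrix_mult_def)

lemma adj_mult [simp]: "(A ** B)\<^sup>H = B\<^sup>H ** (A\<^sup>H :: quat^'n::finite^'k::finite)"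
  by (simp add: vec_eq_iff matrix_matrix_mult_def qcnj_sum)

lemma adj_diff [simp]: "(A - B)\<^sup>H = A\<^sup>H - B\<^sup>H"
  by (simp add: vec_eq_iff quat_eq_iff)

lemma adj_scaleR [simp]: "(r *\<^sub>R A)\<^sup>H = r *\<^sub>R A\<^sup>H"
  by (simp add: vec_eq_iff)

lemma adj_0 [simp]: "0\<^sup>H = 0"
  by (simp add: vec_eq_iff)

lemma adj_mat_1 [simp]: "(mat 1)\<^sup>H = mat 1"
  by (simp add: vec_eq_iff mat_def)

lemma mat_of_real: "mat (of_real r) = (r *\<^sub>R mat 1 :: 'n::finite qmat)"
  by (simp add: vec_eq_iff mat_def of_real_def)

lemma mpow_add: "A ^^^ (m + n) = A ^^^ m ** A ^^^ n"
  by (induction m) (simp_all add: matrix_mul_assoc)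

lemma mpow_commutes:
  assumes "X ** A = A ** X" shows "X ** A ^^^ k = A ^^^ k ** X"
  by (induction k) (simp_all, metis assms matrix_mul_assoc)

lemma mpow_Suc_right: "A ^^^ Suc k = A ^^^ k ** A"
  using mpow_commutes[of A A k] by simp

lemma adj_mpow [simp]: "(A ^^^ k)\<^sup>H = (A\<^sup>H) ^^^ k"
  by (induction k) (simp_all add: mpow_commutes)

lemma hermitian_mpow: "hermitian A \<Longrightarrow> hermitian (A ^^^ k)"
  by (simp add: hermitian_def)

lemma hermitian_mult_adj [simp]: "hermitian (A ** A\<^sup>H)" "hermitian (A\<^sup>H ** A)"
  by (simp_all add: hermitian_def)

section \<open>The real trace and its definiteness\<close>

lemma rtr_diff: "rtr (A - B) = rtr A - rtr B"
  by (simp add: rtr_def sum_subtractf)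

lemma rtr_scaleR: "rtr (r *\<^sub>R A) = r * rtr A"
  by (simp add: rtr_def sum_distrib_left)

lemma rtr_commute: "rtr (A ** B) = rtr (B ** A)"
proof -
  have "rtr (A ** B) = (\<Sum>i\<in>UNIV. \<Sum>k\<in>UNIV. qre (B $ k $ i * A $ i $ k))"
    by (simp add: rtr_def matrix_matrix_mult_def qre_sum qre_mult_commute)
  also have "\<dots> = rtr (B ** A)"
    by (subst sum.swap) (simp add: rtr_def matrix_matrix_mult_def qre_sum)
  finally show ?thesis .
qed

lemma qnorm2_nonneg: "qnorm2 x \<ge> 0"
  by (simp add: qnorm2_def)

text \<open>The squared Frobenius norm, so \<open>A\<^sup>H ** A\<close> vanishes only with
  \<open>A\<close>.\<close>

lemma rtr_adj_mult: "rtr (A\<^sup>H ** A) = (\<Sum>j\<in>UNIV. \<Sum>i\<in>UNIV. qnorm2 (A $ i $ j))"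
  by (simp add: rtr_def matrix_matrix_mult_def qre_sum quat_mult_sel qnorm2_def power2_eq_square)

lemma rtr_adj_mult_nonneg: "rtr (A\<^sup>H ** A) \<ge> 0"
  unfolding rtr_adj_mult by (intro sum_nonneg qnorm2_nonneg)

lemma rtr_adj_mult_eq_0:
  assumes "rtr (A\<^sup>H ** A) = 0" shows "A = 0"
proof -
  have "qnorm2 (A $ i $ j) = 0" for i j
  proof -
    have "(\<Sum>i\<in>UNIV. qnorm2 (A $ i $ j)) = 0"
      using assms unfolding rtr_adj_mult
      by (subst (asm) sum_nonneg_eq_0_iff) (auto intro: sum_nonneg qnorm2_nonneg)
    then show ?thesis
      by (subst (asm) sum_nonneg_eq_0_iff) (auto intro: qnorm2_nonneg)
  qed
  then show ?thesis
    by (simp add: qnorm2_eq_0_iff vec_eq_iff)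
qed

lemma adj_mult_eq_0: "A\<^sup>H ** A = 0 \<Longrightarrow> A = 0"
  by (rule rtr_adj_mult_eq_0) (simp add: rtr_def)

text \<open>For \<open>Y = M ^^^ Suc j ** X\<close> the product \<open>Y\<^sup>H ** Y\<close>
  contains one more power of \<open>M\<close> next to \<open>X\<close>. So it vanishes, and
  \<open>Y\<close> with it; powers are removed one at a time.\<close>

lemma hermitian_mpow_mult_eq_0:
  assumes "hermitian M" "M ^^^ Suc j ** X = 0"
  shows "M ** X = 0"
  using assms(2)
proof (induction j)
  case (Suc j)
  let ?Y = "M ^^^ Suc j ** X"
  have "?Y\<^sup>H ** ?Y = X\<^sup>H ** M ^^^ j ** (M ^^^ Suc (Suc j) ** X)"
    using assms(1) by (simp add: hermitian_def matrix_mul_assoc)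
  also have "\<dots> = 0"
    unfolding Suc.prems by (rule matrix_zero_right)
  finally show ?case
    by (rule Suc.IH[OF adj_mult_eq_0])
qed simp

section \<open>Bases and the rank of the range of a projector\<close>

lemma rscale_simps:
  "v *\<^sub>r 1 = v" "v *\<^sub>r 0 = 0" "0 *\<^sub>r a = 0" "(v + w) *\<^sub>r a = v *\<^sub>r a + w *\<^sub>r a"
  "v *\<^sub>r (a + b) = v *\<^sub>r a + v *\<^sub>r b" "v *\<^sub>r (a * b) = v *\<^sub>r a *\<^sub>r b" "v *\<^sub>r (- a) = - (v *\<^sub>r a)"
  by (simp_all add: rscale_def vec_eq_iff algebra_simps)

lemma rscale_sum_left: "(\<Sum>x\<in>S. f x) *\<^sub>r a = (\<Sum>x\<in>S. f x *\<^sub>r a)"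
  by (induction S rule: infinite_finite_induct) (simp_all add: rscale_simps)

lemma rscale_sum_right: "v *\<^sub>r (\<Sum>x\<in>S. f x) = (\<Sum>x\<in>S. v *\<^sub>r f x)"
  by (induction S rule: infinite_finite_induct) (simp_all add: rscale_simps)

lemma matrix_vector_rscale: "A *v (x *\<^sub>r a) = (A *v x) *\<^sub>r a"
  by (simp add: matrix_vector_mult_def rscale_def vec_eq_iff sum_distrib_right mult.assoc)

lemma matrix_vector_sum: "(A :: quat^'n^'m) *v (\<Sum>x\<in>S. f x) = (\<Sum>x\<in>S. A *v f x)"
  by (induction S rule: infinite_finite_induct) (simp_all add: matrix_vector_right_distrib)

lemma matrix_vector_eq_sum_columns: "A *v x = (\<Sum>j\<in>UNIV. column j A *\<^sub>r (x $ j))"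
  by (simp add: matrix_vector_mult_def rscale_def column_def vec_eq_iff)

lemma column_matrix_mult: "column j (A ** B) = A *v column j B"
  by (simp add: matrix_vector_mult_def matrix_matrix_mult_def column_def vec_eq_iff)

lemma rspanI: "finite T \<Longrightarrow> T \<subseteq> S \<Longrightarrow> (\<Sum>v\<in>T. v *\<^sub>r c v) \<in> rspan S"
  unfolding rspan_def by blast

text \<open>Padding with zero coefficients lets several linear combinations be written over one
  common finite set.\<close>

lemma rspan_superset:
  assumes "x \<in> rspan S"
  shows "\<exists>T c. finite T \<and> T \<subseteq> S \<and>
    (\<forall>T'. finite T' \<longrightarrow> T \<subseteq> T' \<longrightarrow> x = (\<Sum>v\<in>T'. v *\<^sub>r (if v \<in> T then c v else 0)))"
proof -
  from assms obtain T c where T: "finite T" "T \<subseteq> S" "x = (\<Sum>v\<in>T. v *\<^sub>r c v)"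
    unfolding rspan_def by blast
  have "x = (\<Sum>v\<in>T'. v *\<^sub>r (if v \<in> T then c v else 0))" if "finite T'" "T \<subseteq> T'" for T'
    unfolding T(3) by (rule sum.mono_neutral_cong_left[OF that]) (auto simp: rscale_simps)
  with T(1,2) show ?thesis by blast
qed

lemma rspan_base: "v \<in> S \<Longrightarrow> v \<in> rspan S"
  using rspanI[of "{v}" S "\<lambda>_. 1"] by (simp add: rscale_simps)

lemma rspan_0: "0 \<in> rspan S"
  using rspanI[of "{}" S] by simp

lemma rspan_add:
  assumes "x \<in> rspan S" "y \<in> rspan S" shows "x + y \<in> rspan S"
proof -
  obtain T c where T: "finite T" "T \<subseteq> S"
    and x: "\<forall>T'. finite T' \<longrightarrow> T \<subseteq> T' \<longrightarrow> x = (\<Sum>v\<in>T'. v *\<^sub>r (if v \<in> T then c v else 0))"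
    using rspan_superset[OF assms(1)] by blast
  obtain U d where U: "finite U" "U \<subseteq> S"
    and y: "\<forall>T'. finite T' \<longrightarrow> U \<subseteq> T' \<longrightarrow> y = (\<Sum>v\<in>T'. v *\<^sub>r (if v \<in> U then d v else 0))"
    using rspan_superset[OF assms(2)] by blast
  have "x = (\<Sum>v\<in>T \<union> U. v *\<^sub>r (if v \<in> T then c v else 0))"
    by (rule x[rule_format]) (use T U in auto)
  moreover have "y = (\<Sum>v\<in>T \<union> U. v *\<^sub>r (if v \<in> U then d v else 0))"
    by (rule y[rule_format]) (use T U in auto)
  ultimately have "x + y = (\<Sum>v\<in>T \<union> U. v *\<^sub>r (if v \<in> T then c v else 0)) +
      (\<Sum>v\<in>T \<union> U. v *\<^sub>r (if v \<in> U then d v else 0))"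
    by (rule arg_cong2)
  also have "\<dots> = (\<Sum>v\<in>T \<union> U. v *\<^sub>r ((if v \<in> T then c v else 0) + (if v \<in> U then d v else 0)))"
    by (simp only: rscale_simps(5) sum.distrib)
  finally show ?thesis
    using rspanI[of "T \<union> U" S] T U by (simp only: finite_Un Un_subset_iff simp_thms)
qed

lemma rspan_rscale:
  assumes "x \<in> rspan S" shows "x *\<^sub>r a \<in> rspan S"
proof -
  from assms obtain T c where T: "finite T" "T \<subseteq> S" "x = (\<Sum>v\<in>T. v *\<^sub>r c v)"
    unfolding rspan_def by blast
  have "x *\<^sub>r a = (\<Sum>v\<in>T. v *\<^sub>r (c v * a))"
    unfolding T(3) rscale_sum_left by (simp add: rscale_simps(6))
  then show ?thesis
    using rspanI[OF T(1,2)] by simp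
qed

lemma rspan_sum: "(\<And>x. x \<in> U \<Longrightarrow> f x \<in> rspan S) \<Longrightarrow> (\<Sum>x\<in>U. f x) \<in> rspan S"
  by (induction U rule: infinite_finite_induct) (simp_all add: rspan_0 rspan_add)

lemma rspan_minimal:
  assumes "S \<subseteq> rspan T" shows "rspan S \<subseteq> rspan T"
proof
  fix x assume "x \<in> rspan S"
  then obtain U c where U: "finite U" "U \<subseteq> S" "x = (\<Sum>v\<in>U. v *\<^sub>r c v)"
    unfolding rspan_def by blast
  show "x \<in> rspan T"
    unfolding U(3) by (intro rspan_sum rspan_rscale) (use U(2) assms in blast)
qed

lemma rspan_mono: "S \<subseteq> T \<Longrightarrow> rspan S \<subseteq> rspan T"
  by (rule rspan_minimal) (auto intro: rspan_base)

text \<open>A vector with nonzero coefficient in a relation is, after division on the right, a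
  combination of the others and can be discarded.\<close>

lemma rbasis_exists:
  assumes "finite S"
  shows "\<exists>B\<subseteq>S. rindependent B \<and> rspan B = rspan S"
  using assms
proof (induction S rule: finite_psubset_induct)
  case (psubset S)
  show ?case
  proof (cases "rindependent S")
    case False
    then obtain T c b where T: "finite T" "T \<subseteq> S" "(\<Sum>v\<in>T. v *\<^sub>r c v) = 0" "b \<in> T" "c b \<noteq> 0"
      unfolding rindependent_def by blast
    have "(\<Sum>v\<in>T. v *\<^sub>r c v) = b *\<^sub>r c b + (\<Sum>v\<in>T - {b}. v *\<^sub>r c v)"
      by (rule sum.remove) (use T in auto)
    then have "b *\<^sub>r c b = - (\<Sum>v\<in>T - {b}. v *\<^sub>r c v)"
      using T(3) by (simp add: eq_neg_iff_add_eq_0)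
    also have "\<dots> = (\<Sum>v\<in>T - {b}. v *\<^sub>r c v) *\<^sub>r (- 1)"
      by (simp add: rscale_simps)
    finally have "b *\<^sub>r c b *\<^sub>r inverse (c b) \<in> rspan (S - {b})"
      using T by (simp only:) (intro rspan_rscale rspanI; auto)
    then have b: "b \<in> rspan (S - {b})"
      using T(5) by (simp add: rscale_simps(6)[symmetric] rscale_simps(1))
    have "rspan S \<subseteq> rspan (S - {b})"
      by (rule rspan_minimal) (use b in \<open>auto intro: rspan_base\<close>)
    then have eq: "rspan (S - {b}) = rspan S"
      using rspan_mono[of "S - {b}" S] by auto
    have "S - {b} \<subset> S" using T by auto
    from psubset.IH[OF this] show ?thesis
      unfolding eq by blast
  qed auto
qed

text \<open>
  Writing the columns of \<open>P\<close> in the basis gives \<open>P = \<Sum>\<^sub>b b d\<^sub>b\<close> with rows \<open>d\<^sub>b\<close>; as \<open>P\<close> fixes the basis,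
  \<open>d\<^sub>b b' = \<delta>\<close>, and each summand has real trace \<open>1\<close>.
\<close>

lemma card_rbasis_eq_rtr:
  assumes P: "P ** A = A" "P = A ** Y" and B: "rindependent B" "rspan B = rspan (columns A)"
  shows "real (card B) = rtr P"
proof -
  have fix_range: "P *v x = x" if x: "x \<in> rspan (columns A)" for x
  proof -
    from x obtain T c where T: "T \<subseteq> columns A" "x = (\<Sum>v\<in>T. v *\<^sub>r c v)"
      unfolding rspan_def by blast
    have "P *v v = v" if "v \<in> T" for v
      using that T(1) P(1) by (auto simp: columns_def column_matrix_mult[symmetric])
    then show ?thesis
      unfolding T(2) by (simp add: matrix_vector_sum matrix_vector_rscale)
  qed
  have "column j P \<in> rspan B" for j
    unfolding P(2) B(2) column_matrix_mult matrix_vector_eq_sum_columns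
    by (intro rspan_sum rspan_rscale rspan_base) (auto simp: columns_def)
  then have "\<forall>j. \<exists>U c. finite U \<and> U \<subseteq> B \<and> (\<forall>T'. finite T' \<longrightarrow> U \<subseteq> T' \<longrightarrow>
      column j P = (\<Sum>v\<in>T'. v *\<^sub>r (if v \<in> U then c v else 0)))"
    by (intro allI rspan_superset)
  then obtain U c where *: "\<forall>j. finite (U j) \<and> U j \<subseteq> B \<and> (\<forall>T'. finite T' \<longrightarrow> U j \<subseteq> T' \<longrightarrow>
      column j P = (\<Sum>v\<in>T'. v *\<^sub>r (if v \<in> U j then c j v else 0)))"
    unfolding choice_iff by blast
  have U: "finite (U j)" "U j \<subseteq> B" for j
    using * by blast+
  have col: "column j P = (\<Sum>v\<in>T'. v *\<^sub>r (if v \<in> U j then c j v else 0))"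
    if "finite T'" "U j \<subseteq> T'" for j T'
    using * that by blast
  define T where "T = (\<Union>j. U j)"
  define d where "d j v = (if v \<in> U j then c j v else 0)" for j v
  have T: "finite T" "T \<subseteq> B"
    using U by (auto simp: T_def)
  have colT: "column j P = (\<Sum>v\<in>T. v *\<^sub>r d j v)" for j
    unfolding d_def by (rule col) (use T in \<open>auto simp: T_def\<close>)
  have exp: "b = (\<Sum>v\<in>T. v *\<^sub>r (\<Sum>j\<in>UNIV. d j v * b $ j))" if "b \<in> B" for b
  proof -
    have "b = P *v b"
      using fix_range rspan_base[OF that] B(2) by simp
    also have "\<dots> = (\<Sum>j\<in>UNIV. \<Sum>v\<in>T. v *\<^sub>r (d j v * b $ j))"
      unfolding matrix_vector_eq_sum_columns colT rscale_sum_left by (simp add: rscale_simps(6))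
    also have "\<dots> = (\<Sum>v\<in>T. \<Sum>j\<in>UNIV. v *\<^sub>r (d j v * b $ j))"
      by (rule sum.swap)
    finally show ?thesis
      by (simp only: rscale_sum_right)
  qed
  have indep: "e v = 0" if "(\<Sum>v\<in>T'. v *\<^sub>r e v) = 0" "finite T'" "T' \<subseteq> B" "v \<in> T'" for T' e v
    using B(1) that unfolding rindependent_def by blast
  have "b \<in> T" if b: "b \<in> B" for b
  proof (rule ccontr)
    assume nb: "b \<notin> T"
    \<comment> \<open>The expansion of \<open>b\<close> over \<open>T\<close> would become a
      relation with coefficient \<open>- 1\<close> at \<open>b\<close>. Hence \<open>B\<close> is
      the finite set \<open>T\<close>.\<close>
    let ?e = "\<lambda>v. if v = b then - 1 else (\<Sum>j\<in>UNIV. d j v * b $ j)"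
    have "(\<Sum>v\<in>T. v *\<^sub>r ?e v) = b"
      by (subst (2) exp[OF b]) (rule sum.cong, use nb in auto)
    then have "(\<Sum>v\<in>insert b T. v *\<^sub>r ?e v) = 0"
      using nb T(1) by (simp add: rscale_simps)
    then have "?e b = 0"
      by (rule indep) (use T b in auto)
    then show False by simp
  qed
  then have BT: "B = T" using T by auto
  have delta: "(\<Sum>j\<in>UNIV. d j v * b $ j) = (if v = b then 1 else 0)" if "b \<in> T" "v \<in> T" for b v
  proof -
    \<comment> \<open>The expansion of \<open>b\<close> minus the trivial one is a relation, so its
      coefficients vanish.\<close>
    let ?e = "\<lambda>v. (\<Sum>j\<in>UNIV. d j v * b $ j) + (if v = b then - 1 else 0)"
    have "(\<Sum>v\<in>T. v *\<^sub>r (if v = b then - 1 else 0)) = (\<Sum>v\<in>T. if v = b then - b else 0)"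
      by (rule sum.cong) (auto simp: rscale_simps)
    then have "(\<Sum>v\<in>T. v *\<^sub>r ?e v) = 0"
      using exp[of b] that BT T(1) by (simp add: rscale_simps(5) sum.distrib)
    then have "?e v = 0"
      by (rule indep) (use T that in auto)
    then show ?thesis by (auto split: if_splits)
  qed
  have "rtr P = (\<Sum>j\<in>UNIV. qre (column j P $ j))"
    by (simp add: rtr_def column_def)
  also have "\<dots> = (\<Sum>j\<in>UNIV. \<Sum>v\<in>T. qre (d j v * v $ j))"
    unfolding colT by (simp add: rscale_def qre_sum qre_mult_commute)
  also have "\<dots> = (\<Sum>v\<in>T. qre (\<Sum>j\<in>UNIV. d j v * v $ j))"
    by (subst sum.swap) (simp add: qre_sum)
  also have "\<dots> = real (card T)"
    by (simp add: delta)
  finally show ?thesis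
    using BT by simp
qed

text \<open>\<open>rdim\<close> takes the size of a basis picked by \<open>SOME\<close>; as all
  bases have size \<open>rtr P\<close>, the choice does not matter. \<open>P\<close> is a projector
  onto the range of \<open>A\<close>, not necessarily orthogonal.\<close>

theorem rk_eq_rtr:
  assumes "P ** A = A" "P = A ** Y"
  shows "real (rk A) = rtr P"
proof -
  have "columns A = range (\<lambda>i. column i A)"
    by (auto simp: columns_def)
  then have "finite (columns A)"
    by simp
  then have "\<exists>B. rindependent B \<and> rspan B = rspan (columns A)"
    using rbasis_exists by blast
  then have "rindependent (SOME B. rindependent B \<and> rspan B = rspan (columns A)) \<and>
      rspan (SOME B. rindependent B \<and> rspan B = rspan (columns A)) = rspan (columns A)"
    by (rule someI_ex)
  then show ?thesis
    unfolding rk_def rdim_def using card_rbasis_eq_rtr[OF assms] by blast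
qed

section \<open>Inner inverses of Hermitian matrices\<close>

lemma rdet_mat_Suc:
  "hermitian M \<Longrightarrow> rdet_mat M (Suc k) = pminor_sum M k *\<^sub>R mat 1 - M ** rdet_mat M k"
  using faddeev_leverrier[of M k] by (simp add: mat_of_real eq_diff_eq add.commute)

text \<open>By the recursion \<open>rdet_mat M k\<close> is a polynomial in \<open>M\<close> with
  real coefficients, which also makes it Hermitian.\<close>

lemma rdet_mat_commutes:
  assumes "hermitian M" "X ** M = M ** X"
  shows "X ** rdet_mat M k = rdet_mat M k ** X"
proof (induction k)
  case (Suc k)
  have "X ** (M ** rdet_mat M k) = M ** rdet_mat M k ** X"
    by (metis Suc assms(2) matrix_mul_assoc)
  then show ?case
    by (simp add: rdet_mat_Suc[OF assms(1)] matrix_diff_ldistrib matrix_diff_rdistrib)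
qed simp

lemma hermitian_rdet_mat: "hermitian M \<Longrightarrow> hermitian (rdet_mat M k)"
proof (induction k)
  case (Suc k)
  then have "(rdet_mat M k)\<^sup>H ** M\<^sup>H = M ** rdet_mat M k"
    using rdet_mat_commutes[of M M k] by (simp add: hermitian_def)
  then show ?case
    by (simp add: hermitian_def rdet_mat_Suc[OF Suc.prems])
qed (simp add: hermitian_def)

theorem
  fixes M :: "'n::{finite,linorder} qmat"
  assumes herm: "hermitian M"
  shows pminor_sum_rk: "pminor_sum M (rk M) \<noteq> 0"
    and rdet_mat_rk: "M ** rdet_mat M (rk M) ** M = pminor_sum M (rk M) *\<^sub>R M"
proof -
  let ?c = "pminor_sum M" and ?R = "rdet_mat M"
  have comm: "?R k ** M = M ** ?R k" for k
    using rdet_mat_commutes[OF herm, of M] by simp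
  define t where "t = Max {k. k \<le> CARD('n) \<and> ?c k \<noteq> 0}"
  have "0 \<in> {k. k \<le> CARD('n) \<and> ?c k \<noteq> 0}" by simp
  then have "t \<in> {k. k \<le> CARD('n) \<and> ?c k \<noteq> 0}"
    unfolding t_def by (intro Max_in) auto
  then have ct: "?c t \<noteq> 0" by simp
  have after: "?c k = 0" if "t < k" for k
  proof (rule ccontr)
    assume "?c k \<noteq> 0"
    then have "k \<in> {k. k \<le> CARD('n) \<and> ?c k \<noteq> 0}"
      using pminor_sum_eq_0[of k M] by fastforce
    then have "k \<le> t" unfolding t_def by (intro Max_ge) auto
    then show False using that by simp
  qed
  \<comment> \<open>Beyond \<open>t\<close> the recursion only multiplies by
    \<open>- M\<close>.\<close>
  have "?R (Suc t + j) = (- 1) ^ j *\<^sub>R (M ^^^ j ** ?R (Suc t))" for j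
  proof (induction j)
    case (Suc j)
    have "?R (Suc t + Suc j) = - (M ** ?R (Suc t + j))"
      using rdet_mat_Suc[OF herm, of "Suc t + j"] after[of "Suc t + j"] by simp
    then show ?case
      unfolding Suc by (simp add: matrix_mul_assoc)
  qed simp
  \<comment> \<open>Beyond the dimension the matrices vanish, so a power of \<open>M\<close>
    annihilates \<open>?R (Suc t)\<close>; since \<open>M\<close> is Hermitian, so does
    \<open>M\<close> itself.\<close>
  from this[of "Suc CARD('n)"] have "(- 1 :: real) ^ Suc CARD('n) *\<^sub>R (M ^^^ Suc CARD('n) ** ?R (Suc t)) = 0"
    using rdet_mat_eq_0[of "Suc t + Suc CARD('n)" M] by simp
  then have "M ^^^ Suc CARD('n) ** ?R (Suc t) = 0"
    unfolding scaleR_eq_0_iff by simp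
  then have "M ** ?R (Suc t) = 0"
    by (rule hermitian_mpow_mult_eq_0[OF herm])
  then have "M ** M ** ?R t = ?c t *\<^sub>R M"
    by (simp add: rdet_mat_Suc[OF herm] matrix_diff_ldistrib matrix_mul_assoc)
  then have MRM: "M ** ?R t ** M = ?c t *\<^sub>R M"
    by (metis comm matrix_mul_assoc)
  define P where "P = (1 / ?c t) *\<^sub>R (M ** ?R t)"
  have "P ** M = M" "P = M ** ((1 / ?c t) *\<^sub>R ?R t)"
    using ct by (simp_all add: P_def MRM)
  then have "real (rk M) = rtr P"
    by (rule rk_eq_rtr)
  also have "\<dots> = real t"
    using ct by (simp add: P_def rtr_scaleR rtr_rdet_mat[OF herm])
  finally have "rk M = t" by simp
  then show "pminor_sum M (rk M) \<noteq> 0" "M ** ?R (rk M) ** M = ?c (rk M) *\<^sub>R M"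
    using ct MRM by simp_all
qed

text \<open>For Hermitian \<open>M\<close> this is a real polynomial in \<open>M\<close> and an
  inner inverse. It need not be an outer inverse: for the diagonal matrix with entries 1 and 0 it is
  the identity.\<close>

definition ginv :: "('n::{finite,linorder}) qmat \<Rightarrow> 'n qmat" where
  "ginv M = (1 / pminor_sum M (rk M)) *\<^sub>R rdet_mat M (rk M)"

lemma rdet_mat_eq_ginv: "hermitian M \<Longrightarrow> rdet_mat M (rk M) = pminor_sum M (rk M) *\<^sub>R ginv M"
  by (simp add: ginv_def pminor_sum_rk)

lemma ginv_inner: "hermitian M \<Longrightarrow> M ** ginv M ** M = M"
  by (simp add: ginv_def rdet_mat_rk pminor_sum_rk)

lemma ginv_commutes: "hermitian M \<Longrightarrow> X ** M = M ** X \<Longrightarrow> X ** ginv M = ginv M ** X"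
  by (simp add: ginv_def rdet_mat_commutes)

lemma hermitian_ginv: "hermitian M \<Longrightarrow> (ginv M)\<^sup>H = ginv M"
  using hermitian_rdet_mat[of M "rk M"] by (simp add: ginv_def hermitian_def)

text \<open>\<open>A\<^sup>H\<close> intertwines the two recursions, and \<open>rtr_rdet_mat\<close>
  recovers the sums of minors from traces that agree by cyclicity.\<close>

lemma pminor_sum_mult_adj:
  fixes A :: "'n::{finite,linorder} qmat"
  shows "pminor_sum (A ** A\<^sup>H) k = pminor_sum (A\<^sup>H ** A) k"
proof -
  have "A\<^sup>H ** rdet_mat (A ** A\<^sup>H) k = rdet_mat (A\<^sup>H ** A) k ** A\<^sup>H \<and>
    pminor_sum (A ** A\<^sup>H) k = pminor_sum (A\<^sup>H ** A) k"
  proof (induction k)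
    case (Suc k)
    let ?R = "rdet_mat (A ** A\<^sup>H)" and ?R' = "rdet_mat (A\<^sup>H ** A)"
    have R: "A\<^sup>H ** ?R k = ?R' k ** A\<^sup>H" and c: "pminor_sum (A ** A\<^sup>H) k = pminor_sum (A\<^sup>H ** A) k"
      using Suc by auto
    have "A\<^sup>H ** (A ** A\<^sup>H ** ?R k) = A\<^sup>H ** A ** ?R' k ** A\<^sup>H"
      by (metis R matrix_mul_assoc)
    then have R': "A\<^sup>H ** ?R (Suc k) = ?R' (Suc k) ** A\<^sup>H"
      by (simp add: rdet_mat_Suc c matrix_diff_ldistrib matrix_diff_rdistrib)
    have "rtr (A ** A\<^sup>H ** ?R (Suc k)) = rtr (A ** (?R' (Suc k) ** A\<^sup>H))"
      by (simp only: R' flip: matrix_mul_assoc)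
    also have "\<dots> = rtr (?R' (Suc k) ** A\<^sup>H ** A)"
      by (rule rtr_commute)
    also have "\<dots> = rtr (A\<^sup>H ** A ** ?R' (Suc k))"
      by (metis rtr_commute matrix_mul_assoc)
    finally have "pminor_sum (A ** A\<^sup>H) (Suc k) = pminor_sum (A\<^sup>H ** A) (Suc k)"
      by (simp add: rtr_rdet_mat)
    with R' show ?case ..
  qed simp
  then show ?thesis ..
qed

section \<open>The Moore--Penrose inverse and ranks\<close>

definition is_MP :: "'n::finite qmat \<Rightarrow> 'n qmat \<Rightarrow> bool" where
  "is_MP A X \<longleftrightarrow> A ** X ** A = A \<and> X ** A ** X = X \<and> (A ** X)\<^sup>H = A ** X \<and> (X ** A)\<^sup>H = X ** A"

lemma is_MP_unique:
  assumes "is_MP A X" "is_MP A Y" shows "X = Y"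
proof -
  have X: "A ** X ** A = A" "X ** A ** X = X" "(A ** X)\<^sup>H = A ** X" "(X ** A)\<^sup>H = X ** A"
    and Y: "A ** Y ** A = A" "Y ** A ** Y = Y" "(A ** Y)\<^sup>H = A ** Y" "(Y ** A)\<^sup>H = Y ** A"
    using assms by (auto simp: is_MP_def)
  have "A ** X = A ** Y ** (A ** X)" by (simp add: Y(1) matrix_mul_assoc)
  then have "(A ** X)\<^sup>H = (A ** X)\<^sup>H ** (A ** Y)\<^sup>H" by (metis adj_mult)
  then have 1: "A ** X = A ** Y" unfolding X(3) Y(3) by (simp add: X(1) matrix_mul_assoc)
  have "X ** A = X ** A ** (Y ** A)" using Y(1) by (metis matrix_mul_assoc)
  then have "(X ** A)\<^sup>H = (Y ** A)\<^sup>H ** (X ** A)\<^sup>H" by (metis adj_mult)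
  then have 2: "X ** A = Y ** A" unfolding X(4) Y(4) using X(1) by (metis matrix_mul_assoc)
  show "X = Y" by (metis 1 2 X(2) Y(2) matrix_mul_assoc)
qed

text \<open>For \<open>D = A - P ** A\<close> the assumptions give
  \<open>D ** D\<^sup>H = 0\<close>; this cancels \<open>A\<^sup>H\<close> on the right.\<close>

lemma adj_cancel:
  assumes "M = A ** A\<^sup>H" "P ** M = M" shows "P ** A = A"
proof -
  let ?D = "A - P ** A"
  have "?D ** ?D\<^sup>H = (M - P ** M) - (M - P ** M) ** P\<^sup>H"
    unfolding assms(1) by (simp add: matrix_diff_ldistrib matrix_diff_rdistrib matrix_mul_assoc)
  then have "(?D\<^sup>H)\<^sup>H ** ?D\<^sup>H = 0" using assms(2) by simp
  then have "?D\<^sup>H = 0" by (rule adj_mult_eq_0)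
  then have "?D = 0" by (metis adj_adj adj_0)
  then show ?thesis by simp
qed

text \<open>With \<open>M = A ** A\<^sup>H\<close> and \<open>G = ginv M\<close>,
  \<open>adj_cancel\<close> turns \<open>M ** G ** M = M\<close> into
  \<open>M ** G ** A = A\<close>, whose adjoint gives the outer identity. The products are Hermitian
  because \<open>G\<close> is and commutes with \<open>M\<close>.\<close>

lemma is_MP_left: "is_MP A (A\<^sup>H ** ginv (A ** A\<^sup>H))"
proof -
  let ?M = "A ** A\<^sup>H" and ?G = "ginv (A ** A\<^sup>H)"
  have MG: "?M ** ?G = ?G ** ?M"
    by (rule ginv_commutes) simp_all
  have PA: "?M ** ?G ** A = A"
    by (rule adj_cancel[OF refl]) (rule ginv_inner, simp)
  have GH: "?G\<^sup>H = ?G" by (rule hermitian_ginv) simp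
  have "A\<^sup>H ** ?G ** ?M = A\<^sup>H"
    using arg_cong[OF PA, of adj] by (simp add: GH matrix_mul_assoc)
  then have AGM: "A\<^sup>H ** ?G ** A ** A\<^sup>H = A\<^sup>H"
    by (simp add: matrix_mul_assoc)
  show ?thesis
    unfolding is_MP_def
    using PA AGM MG by (simp add: matrix_mul_assoc GH)
qed

lemma MP_inverse_eqI: "is_MP A X \<Longrightarrow> A\<^sup>\<dagger> = X"
  unfolding MP_inverse_def is_MP_def[symmetric] by (rule the_equality) (auto intro: is_MP_unique)

lemma MP_inverse_left: "A\<^sup>\<dagger> = A\<^sup>H ** ginv (A ** A\<^sup>H)"
  by (rule MP_inverse_eqI[OF is_MP_left])

lemma is_MP_inverse: "is_MP (A :: 'n::{finite,linorder} qmat) (A\<^sup>\<dagger>)"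
  unfolding MP_inverse_left by (rule is_MP_left)

lemmas MP_inverse_props = is_MP_inverse[unfolded is_MP_def]

lemma is_MP_adj: "is_MP A X \<Longrightarrow> is_MP (A\<^sup>H) (X\<^sup>H)"
proof -
  assume X: "is_MP A X"
  have "A\<^sup>H ** X\<^sup>H = X ** A" "X\<^sup>H ** A\<^sup>H = A ** X"
    using X by (simp_all add: is_MP_def)
  moreover have "A\<^sup>H ** X\<^sup>H ** A\<^sup>H = (A ** X ** A)\<^sup>H" "X\<^sup>H ** A\<^sup>H ** X\<^sup>H = (X ** A ** X)\<^sup>H"
    by (simp_all add: matrix_mul_assoc)
  ultimately show ?thesis
    using X unfolding is_MP_def by metis
qed

lemma MP_inverse_adj: "((A :: 'n::{finite,linorder} qmat)\<^sup>H)\<^sup>\<dagger> = (A\<^sup>\<dagger>)\<^sup>H"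
  by (rule MP_inverse_eqI[OF is_MP_adj[OF is_MP_inverse]])

lemma MP_inverse_right: "A\<^sup>\<dagger> = ginv (A\<^sup>H ** A) ** A\<^sup>H"
proof -
  have "(A\<^sup>\<dagger>)\<^sup>H = A ** ginv (A\<^sup>H ** A)"
    using MP_inverse_left[of "A\<^sup>H"] by (simp add: MP_inverse_adj)
  then have "((A\<^sup>\<dagger>)\<^sup>H)\<^sup>H = (A ** ginv (A\<^sup>H ** A))\<^sup>H"
    by (rule arg_cong)
  then show ?thesis
    by (simp add: hermitian_ginv)
qed

section \<open>Ranks as traces of orthogonal projectors\<close>

abbreviation proj :: "('n::{finite,linorder}) qmat \<Rightarrow> 'n qmat" where
  "proj A \<equiv> A ** A\<^sup>\<dagger>"

lemma rk_eq_rtr_proj: "real (rk (A :: 'n::{finite,linorder} qmat)) = rtr (proj A)"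
  by (rule rk_eq_rtr) (simp_all add: MP_inverse_props)

text \<open>The projectors onto the ranges of \<open>A\<close> and \<open>A\<^sup>H\<close> are
  \<open>A ** A\<^sup>\<dagger>\<close> and \<open>A\<^sup>\<dagger> ** A\<close>, whose real traces
  agree.\<close>

lemma rk_adj: "rk ((A :: 'n::{finite,linorder} qmat)\<^sup>H) = rk A"
proof -
  have "real (rk (A\<^sup>H)) = rtr (A\<^sup>H ** (A\<^sup>\<dagger>)\<^sup>H)"
    by (simp add: rk_eq_rtr_proj MP_inverse_adj)
  also have "A\<^sup>H ** (A\<^sup>\<dagger>)\<^sup>H = A\<^sup>\<dagger> ** A"
    using MP_inverse_props[of A] by simp
  also have "rtr (A\<^sup>\<dagger> ** A) = real (rk A)"
    unfolding rk_eq_rtr_proj by (rule rtr_commute)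
  finally show ?thesis by simp
qed

lemma rk_mult_adj: "rk ((A :: 'n::{finite,linorder} qmat) ** A\<^sup>H) = rk A"
proof -
  have "real (rk (A ** A\<^sup>H)) = rtr (proj A)"
  proof (rule rk_eq_rtr)
    show "proj A ** (A ** A\<^sup>H) = A ** A\<^sup>H"
      using MP_inverse_props[of A] by (simp add: matrix_mul_assoc)
    show "proj A = A ** A\<^sup>H ** ginv (A ** A\<^sup>H)"
      by (simp add: MP_inverse_left matrix_mul_assoc)
  qed
  then show ?thesis
    using rk_eq_rtr_proj[of A] by simp
qed

lemma rk_adj_mult: "rk ((A :: 'n::{finite,linorder} qmat)\<^sup>H ** A) = rk A"
  using rk_mult_adj[of "A\<^sup>H"] by (simp add: rk_adj)

text \<open>The difference of the two orthogonal projectors is again one, so its squared Frobenius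
  norm is its trace, the difference of the ranks. Equal ranks force equal projectors.\<close>

lemma
  fixes A B :: "'n::{finite,linorder} qmat"
  shows rk_mult_le: "rk (A ** B) \<le> rk A"
    and rk_mult_eq: "rk (A ** B) = rk A \<Longrightarrow> \<exists>Z. A = A ** B ** Z"
proof -
  let ?P = "proj A" and ?Q = "proj (A ** B)"
  have P: "?P ** ?P = ?P" "?P\<^sup>H = ?P" and Q: "?Q ** ?Q = ?Q" "?Q\<^sup>H = ?Q"
    using MP_inverse_props[of A] MP_inverse_props[of "A ** B"] by (simp_all add: matrix_mul_assoc)
  have PQ: "?P ** ?Q = ?Q"
    using MP_inverse_props[of A] by (simp add: matrix_mul_assoc)
  then have QP: "?Q ** ?P = ?Q"
    by (metis P(2) Q(2) adj_mult)
  have D: "(?P - ?Q)\<^sup>H ** (?P - ?Q) = ?P - ?Q"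
    unfolding adj_diff P(2) Q(2) by (simp only: matrix_diff_ldistrib matrix_diff_rdistrib P Q PQ QP) simp
  have r: "rtr ((?P - ?Q)\<^sup>H ** (?P - ?Q)) = real (rk A) - real (rk (A ** B))"
    unfolding D rtr_diff rk_eq_rtr_proj ..
  then show "rk (A ** B) \<le> rk A"
    using rtr_adj_mult_nonneg[of "?P - ?Q"] by simp
  assume "rk (A ** B) = rk A"
  then have "?P - ?Q = 0"
    using r by (intro rtr_adj_mult_eq_0) simp
  then have "A = ?Q ** A"
    using MP_inverse_props[of A] by simp
  then show "\<exists>Z. A = A ** B ** Z"
    by (metis matrix_mul_assoc)
qed

lemma rk_mult_eq':
  fixes A B :: "'n::{finite,linorder} qmat"
  assumes "rk (B ** A) = rk A" shows "\<exists>Z. A = Z ** B ** A"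
proof -
  have "rk (A\<^sup>H ** B\<^sup>H) = rk (A\<^sup>H)"
    using assms rk_adj[of "B ** A"] by (simp add: rk_adj)
  then obtain Z where "A\<^sup>H = A\<^sup>H ** B\<^sup>H ** Z"
    using rk_mult_eq by blast
  then have "(A\<^sup>H)\<^sup>H = (A\<^sup>H ** B\<^sup>H ** Z)\<^sup>H"
    by (rule arg_cong)
  then show ?thesis
    by (auto simp: matrix_mul_assoc)
qed

section \<open>Index and Drazin inverse\<close>

text \<open>\<open>LEAST\<close> ranges over a nonempty set, since the ranks of the powers cannot
  decrease strictly for ever.\<close>

lemma rk_mpow_Ind: "rk ((A :: 'n::{finite,linorder} qmat) ^^^ (Ind A + 1)) = rk (A ^^^ Ind A)"
proof -
  have "\<exists>k. rk (A ^^^ (k + 1)) = rk (A ^^^ k)"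
  proof (rule ccontr)
    assume nex: "\<nexists>k. rk (A ^^^ (k + 1)) = rk (A ^^^ k)"
    have less: "rk (A ^^^ Suc k) < rk (A ^^^ k)" for k
      using rk_mult_le[of "A ^^^ k" A] nex by (metis Suc_eq_plus1 le_neq_implies_less mpow_Suc_right)
    have "rk (A ^^^ k) + k \<le> rk (A ^^^ 0)" for k
    proof (induction k)
      case (Suc k)
      then show ?case using less[of k] by linarith
    qed simp
    from this[of "Suc (rk (A ^^^ 0))"] show False by simp
  qed
  then show ?thesis
    unfolding Ind_def by (rule LeastI_ex)
qed

text \<open>Equal ranks give a factorization through the next power; inserting it into itself raises
  the exponent.\<close>

lemma mpow_Ind_right: "\<exists>Z. (A :: 'n::{finite,linorder} qmat) ^^^ Ind A = A ^^^ (Ind A + j) ** Z"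
proof -
  let ?m = "Ind A"
  have "A ^^^ (?m + 1) = A ^^^ ?m ** A"
    by (simp add: mpow_Suc_right del: mpow.simps(2))
  then obtain Z where Z: "A ^^^ ?m = A ^^^ ?m ** A ** Z"
    using rk_mult_eq[of "A ^^^ ?m" A] rk_mpow_Ind[of A] by (simp del: mpow.simps(2)) blast
  show ?thesis
  proof (induction j)
    case 0
    show ?case by (rule exI[of _ "mat 1"]) simp
  next
    case (Suc j)
    then obtain Y where Y: "A ^^^ ?m = A ^^^ (?m + j) ** Y" by blast
    have "A ^^^ ?m = A ^^^ (j + ?m) ** Y" using Y by (simp add: add.commute)
    also have "\<dots> = A ^^^ j ** (A ^^^ ?m ** A ** Z) ** Y"
      unfolding mpow_add using Z by simp
    also have "\<dots> = A ^^^ (?m + Suc j) ** (Z ** Y)"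
      by (simp add: matrix_mul_assoc mpow_add mpow_Suc_right del: mpow.simps(2))
         (metis matrix_mul_assoc mpow_add add.commute)
    finally show ?case by blast
  qed
qed

lemma mpow_Ind_left: "\<exists>Z. (A :: 'n::{finite,linorder} qmat) ^^^ Ind A = Z ** A ^^^ (Ind A + j)"
proof -
  let ?m = "Ind A"
  obtain Z where Z: "A ^^^ ?m = Z ** A ** A ^^^ ?m"
    using rk_mult_eq'[of A "A ^^^ ?m"] rk_mpow_Ind[of A] by auto
  show ?thesis
  proof (induction j)
    case 0
    show ?case by (rule exI[of _ "mat 1"]) simp
  next
    case (Suc j)
    then obtain Y where "A ^^^ ?m = Y ** A ^^^ (?m + j)" by blast
    also have "\<dots> = Y ** (Z ** A ** A ^^^ ?m) ** A ^^^ j"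
      unfolding mpow_add using Z by (simp add: matrix_mul_assoc)
    also have "\<dots> = (Y ** Z) ** A ^^^ (?m + Suc j)"
      by (simp add: matrix_mul_assoc mpow_add)
    finally show ?case by blast
  qed
qed

lemma rk_mpow_add_Ind: "rk ((A :: 'n::{finite,linorder} qmat) ^^^ (Ind A + j)) = rk (A ^^^ Ind A)"
proof (rule antisym)
  show "rk (A ^^^ (Ind A + j)) \<le> rk (A ^^^ Ind A)"
    unfolding mpow_add by (rule rk_mult_le)
  show "rk (A ^^^ Ind A) \<le> rk (A ^^^ (Ind A + j))"
    using mpow_Ind_right[of A j] rk_mult_le by metis
qed

lemma Drazin_power:
  assumes "X ** A ** X = X" "A ** X = X ** A"
  shows "A ** X = A ^^^ Suc k ** X ^^^ Suc k"
proof (induction k)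
  case (Suc k)
  have "A ^^^ Suc (Suc k) ** X ^^^ Suc (Suc k) = A ** (A ^^^ Suc k ** X ^^^ Suc k) ** X"
    by (simp add: mpow_Suc_right[of X "Suc k"] matrix_mul_assoc del: mpow.simps(2))
      (simp add: matrix_mul_assoc)
  also have "\<dots> = A ** (A ** X) ** X"
    using Suc by simp
  also have "\<dots> = A ** X"
    using assms by (metis matrix_mul_assoc)
  finally show ?case by simp
qed simp

text \<open>For solutions \<open>V\<close> and \<open>W\<close>, \<open>Drazin_power\<close> writes
  \<open>A ** V\<close> as a product with \<open>A ^^^ (Ind A + 1)\<close>, which absorbs
  \<open>A ** W\<close> on either side. So \<open>A ** X\<close> and \<open>A ** Y\<close> coincide,
  and then \<open>X\<close> and \<open>Y\<close>.\<close>

lemma Drazin_inverse_eqI: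
  assumes X: "X ** A ** X = X" "A ** X = X ** A" "X ** A ^^^ (Ind A + 1) = A ^^^ Ind A"
  shows "A\<^sup>d = X"
  unfolding Drazin_inverse_def
proof (rule the_equality)
  fix Y assume "Y ** A ** Y = Y \<and> A ** Y = Y ** A \<and> Y ** A ^^^ (Ind A + 1) = A ^^^ Ind A"
  then have Y: "Y ** A ** Y = Y" "A ** Y = Y ** A" "Y ** A ^^^ (Ind A + 1) = A ^^^ Ind A" by auto
  let ?p = "A ^^^ (Ind A + 1)"
  have p: "A ** A ^^^ Ind A = ?p"
    by simp
  have key: "A ** V = A ** W ** (A ** V)" "A ** V = A ** V ** (A ** W)"
    if V: "V ** A ** V = V" "A ** V = V ** A" and W: "A ** W = W ** A" "W ** ?p = A ^^^ Ind A" for V W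
  proof -
    let ?q = "V ^^^ (Ind A + 1)"
    have AV: "A ** V = ?p ** ?q"
      using Drazin_power[OF V, of "Ind A"] by (simp only: Suc_eq_plus1)
    have pq: "?p ** ?q = ?q ** ?p"
      using mpow_commutes[of A V "Ind A + 1"] mpow_commutes[of ?q A "Ind A + 1"] V(2) by metis
    have "A ** W ** ?p = ?p"
      using W(2) p by (metis matrix_mul_assoc)
    then show "A ** V = A ** W ** (A ** V)"
      unfolding AV by (metis matrix_mul_assoc)
    have "?p ** (A ** W) = W ** ?p ** A"
      using mpow_commutes[of W A "Ind A + 1"] W(1) by (metis matrix_mul_assoc)
    also have "\<dots> = ?p"
      unfolding W(2) using mpow_Suc_right[of A "Ind A"] by (simp only: Suc_eq_plus1)
    finally show "A ** V = A ** V ** (A ** W)"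
      unfolding AV pq by (metis matrix_mul_assoc)
  qed
  have "A ** Y = A ** Y ** (A ** X)"
    by (rule key(2)) (use X Y in auto)
  also have "\<dots> = A ** X"
    by (rule key(1)[symmetric]) (use X Y in auto)
  finally have AYX: "A ** Y = A ** X" .
  show "Y = X"
    by (metis AYX X(1,2) Y(1,2) matrix_mul_assoc)
qed (use X in auto)

text \<open>\<open>A ^^^ Ind A\<close> factors through \<open>B = A ^^^ (2 * Ind A + 1)\<close> on
  both sides, so of the Moore-Penrose equations only \<open>B ** B\<^sup>\<dagger> ** B = B\<close>
  enters.\<close>

theorem Drazin_inverse_eq_MP_inverse:
  fixes A :: "'n::{finite,linorder} qmat"
  shows "A\<^sup>d = A ^^^ Ind A ** (A ^^^ (2 * Ind A + 1))\<^sup>\<dagger> ** A ^^^ Ind A"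
proof (rule Drazin_inverse_eqI)
  let ?p = "A ^^^ Ind A" and ?B = "A ^^^ (2 * Ind A + 1)"
  let ?D = "?p ** ?B\<^sup>\<dagger> ** ?p"
  have idx: "Ind A + (Ind A + 1) = 2 * Ind A + 1" by simp
  obtain Z where Z: "?p = ?B ** Z"
    using mpow_Ind_right[of A "Ind A + 1"] unfolding idx by blast
  obtain Y where Y: "?p = Y ** ?B"
    using mpow_Ind_left[of A "Ind A + 1"] unfolding idx by blast
  have comm: "A ** ?p = ?p ** A" "A ** ?B = ?B ** A"
    using mpow_commutes[of A A] by blast+
  have B: "?B = ?p ** A ** ?p" "?B = ?p ** A ^^^ (Ind A + 1)"
    using mpow_add[of A "Ind A" "Ind A + 1"] unfolding idx by (simp_all add: matrix_mul_assoc)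
  have "?D = Y ** (?B ** ?B\<^sup>\<dagger> ** ?B) ** Z"
    by (metis Y Z matrix_mul_assoc)
  then have "?D = Y ** ?B ** Z"
    unfolding MP_inverse_props(1)[of ?B, THEN conjunct1] .
  then have D: "?D = Y ** ?p" "?D = ?p ** Z"
    using Y Z by (metis matrix_mul_assoc)+
  \<comment> \<open>With \<open>p\<close> for \<open>?p\<close> and \<open>B\<close> for
    \<open>?B\<close>: \<open>A p Z = p A Z = Y B A Z = Y A B Z = Y A p = Y p A\<close>.\<close>
  show "A ** ?D = ?D ** A"
    using D comm Y Z by (metis matrix_mul_assoc)
  have "?D ** A ** ?D = Y ** (?p ** A ** ?p) ** Z"
    using D by (metis matrix_mul_assoc)
  then show "?D ** A ** ?D = ?D"
    unfolding B(1)[symmetric] using D Y by metis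
  have "?D ** A ^^^ (Ind A + 1) = Y ** (?p ** A ^^^ (Ind A + 1))"
    unfolding D(1) by (simp only: matrix_mul_assoc)
  then show "?D ** A ^^^ (Ind A + 1) = ?p"
    unfolding B(2)[symmetric] using Y by metis
qed

text \<open>The inner inverse of \<open>A ^^^ (Ind A + 1)\<close> commutes with \<open>A\<close>,
  being a polynomial in a power of \<open>A\<close>, and its product with that power fixes
  \<open>A ^^^ Ind A\<close>.\<close>

theorem Drazin_inverse_hermitian:
  fixes A :: "'n::{finite,linorder} qmat"
  assumes "hermitian A"
  shows "A\<^sup>d = A ^^^ Ind A ** ginv (A ^^^ (Ind A + 1))"
    and "A ** ginv (A ^^^ (Ind A + 1)) = ginv (A ^^^ (Ind A + 1)) ** A"
proof -
  let ?p = "A ^^^ Ind A" and ?M = "A ^^^ (Ind A + 1)" and ?G = "ginv (A ^^^ (Ind A + 1))"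
  have herm: "hermitian ?M" by (rule hermitian_mpow[OF assms])
  show AG: "A ** ?G = ?G ** A"
    by (rule ginv_commutes[OF herm]) (rule mpow_commutes[OF refl])
  have Ap: "A ** ?p = ?M" "?p ** A = ?M"
    using mpow_Suc_right[of A "Ind A"] by simp_all
  have pG: "?G ** ?p = ?p ** ?G" and MG: "?G ** ?M = ?M ** ?G"
    using AG[symmetric] by (rule mpow_commutes)+
  obtain Z where Z: "?p = ?M ** Z"
    using mpow_Ind_right by blast
  have MGp: "?M ** ?G ** ?p = ?p"
    using ginv_inner[OF herm] Z by (metis matrix_mul_assoc)
  show "A\<^sup>d = ?p ** ?G"
  proof (rule Drazin_inverse_eqI)
    show comm: "A ** (?p ** ?G) = ?p ** ?G ** A"
      using AG Ap by (metis matrix_mul_assoc)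
    have "A ** (?p ** ?G) = ?M ** ?G"
      using Ap by (metis matrix_mul_assoc)
    then show "?p ** ?G ** A ** (?p ** ?G) = ?p ** ?G"
      using comm MGp by (metis matrix_mul_assoc)
    have "?p ** ?M = ?M ** ?p"
      using mpow_add[of A "Ind A" "Ind A + 1"] mpow_add[of A "Ind A + 1" "Ind A"] by (metis add.commute)
    then show "?p ** ?G ** ?M = ?p"
      using MGp pG MG by (metis matrix_mul_assoc)
  qed
qed

section \<open>Determinantal representations of the CMP inverse\<close>

lemma cdet_sum_column_hermitian:
  "hermitian M \<Longrightarrow> cdet_sum k i M (column t Y) = (rdet_mat M k ** Y) $ i $ t"
  using hermitian_rdet_mat[of M k] by (simp add: cdet_sum_column hermitian_def)

text \<open>Together with \<open>cdet_sum_columns\<close> this rewrites each nested family of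
  determinant sums as a matrix product.\<close>

lemma rdet_sum_rows: "(\<chi> i j. rdet_sum k j M (row i Y)) = Y ** rdet_mat M k"
  by (simp add: vec_eq_iff rdet_sum_row)

lemma cdet_sum_columns:
  "hermitian M \<Longrightarrow> (\<chi> i j. cdet_sum k i M (column j Y)) = rdet_mat M k ** Y"
  by (simp add: vec_eq_iff cdet_sum_column_hermitian)

text \<open>The sums of minors of \<open>A\<^sup>H ** A\<close> and \<open>A ** A\<^sup>H\<close>
  agree, so one constant serves both. A positive rank keeps \<open>minor_sum\<close> away from the
  empty index set.\<close>

lemma
  fixes A :: "'n::{finite,linorder} qmat"
  shows minor_sum_adj_mult: "rk A \<ge> 1 \<Longrightarrow> minor_sum (rk A) (A\<^sup>H ** A) = pminor_sum (A\<^sup>H ** A) (rk A)"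
    and minor_sum_mult_adj: "rk A \<ge> 1 \<Longrightarrow> minor_sum (rk A) (A ** A\<^sup>H) = pminor_sum (A\<^sup>H ** A) (rk A)"
    and pminor_sum_adj_mult_rk: "pminor_sum (A\<^sup>H ** A) (rk A) \<noteq> 0"
    and rdet_mat_adj_mult: "rdet_mat (A\<^sup>H ** A) (rk A) ** A\<^sup>H = pminor_sum (A\<^sup>H ** A) (rk A) *\<^sub>R A\<^sup>\<dagger>"
    and rdet_mat_mult_adj: "A\<^sup>H ** rdet_mat (A ** A\<^sup>H) (rk A) = pminor_sum (A\<^sup>H ** A) (rk A) *\<^sub>R A\<^sup>\<dagger>"
  using pminor_sum_rk[of "A\<^sup>H ** A"] rdet_mat_eq_ginv[of "A\<^sup>H ** A"] rdet_mat_eq_ginv[of "A ** A\<^sup>H"]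
  by (simp_all add: minor_sum_eq_pminor_sum pminor_sum_mult_adj rk_adj_mult rk_mult_adj
      MP_inverse_right[symmetric] MP_inverse_left[symmetric])

lemma quat_eq_scaleR_divide: "r \<noteq> 0 \<Longrightarrow> y = r *\<^sub>R x \<Longrightarrow> x = y / (of_real r :: quat)"
  by (simp add: quat_mult_of_real divide_quat_def of_real_inverse[symmetric] del: of_real_inverse)

text \<open>The two formulas are the two bracketings of one triple product.\<close>

lemma CMP_inverse_representation:
  fixes P R M Y X :: "'n::{finite,linorder} qmat"
  assumes "hermitian P" "hermitian M" "rdet_mat P s ** Y ** rdet_mat M s = (c\<^sup>2 * d) *\<^sub>R X"
    and "minor_sum s P = c" "minor_sum s M = c" "d' = d" "c \<noteq> 0" "d \<noteq> 0"
  shows "X $ i $ j = cdet_sum s i P (column j (Y ** rdet_mat M s)) / of_real ((minor_sum s P)\<^sup>2 * d')"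
    and "X $ i $ j = rdet_sum s j M (row i (rdet_mat P s ** Y)) / of_real ((minor_sum s M)\<^sup>2 * d')"
  using assms
  by (auto intro!: quat_eq_scaleR_divide simp: cdet_sum_column_hermitian rdet_sum_row matrix_mul_assoc
      simp del: of_real_mult of_real_power)

text \<open>For Hermitian \<open>A\<close> the inner determinants are those of
  \<open>A ^^^ (m + 1)\<close> itself, so the second part needs its own formula for the Drazin
  inverse. In the general \<open>Ghat\<close> the exponent \<open>m + 1\<close> comes from
  \<open>A\<close> times the factor \<open>A ^^^ m\<close> of the Drazin inverse.\<close>

theorem theorem3p16:
  fixes A X :: "'n::{finite,linorder} qmat" and s m s\<^sub>1 :: nat
  assumes "rk A = s" and "Ind A = m" and "rk (A ^^^ m) = s\<^sub>1" and "s\<^sub>1 \<ge> 1"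
    and "X = CMP_inverse A"
  shows
    "(let B = A ^^^ (2 * m + 1);
          U = (\<chi> i j. rdet_sum s\<^sub>1 j (B ** B\<^sup>H) (row i (A\<^sup>H ** A ^^^ (m + 1) ** B\<^sup>H)));
          G = (\<chi> i j. cdet_sum s\<^sub>1 i (B\<^sup>H ** B) (column j (B\<^sup>H ** A ^^^ (m + 1) ** A\<^sup>H)));
          Uhat = U ** A ^^^ (m + 1) ** A\<^sup>H;
          Ghat = A\<^sup>H ** A ^^^ (m + 1) ** G;
          V1 = (\<chi> t j. rdet_sum s j (A ** A\<^sup>H) (row t Uhat));
          W1 = (\<chi> i k. cdet_sum s i (A\<^sup>H ** A) (column k Uhat));
          V2 = (\<chi> t j. rdet_sum s j (A ** A\<^sup>H) (row t Ghat));
          W2 = (\<chi> i k. cdet_sum s i (A\<^sup>H ** A) (column k Ghat))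
      in \<forall>i j. \<forall>(V, W) \<in> {(V1, W1), (V2, W2)}.
          X $ i $ j = cdet_sum s i (A\<^sup>H ** A) (column j V) /
            of_real ((minor_sum s (A\<^sup>H ** A))\<^sup>2 * minor_sum s\<^sub>1 (B\<^sup>H ** B)) \<and>
          X $ i $ j = rdet_sum s j (A ** A\<^sup>H) (row i W) /
            of_real ((minor_sum s (A ** A\<^sup>H))\<^sup>2 * minor_sum s\<^sub>1 (B\<^sup>H ** B)))
     \<and>
     (hermitian A \<longrightarrow>
     (let U = (\<chi> i j. rdet_sum s\<^sub>1 j (A ^^^ (m + 1)) (row i (A ^^^ (m + 2))));
          G = (\<chi> i j. cdet_sum s\<^sub>1 i (A ^^^ (m + 1)) (column j (A ^^^ (m + 2))));
          Uhat = U ** A ^^^ 2;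
          Ghat = A ^^^ 2 ** G;
          V1 = (\<chi> t j. rdet_sum s j (A ^^^ 2) (row t Uhat));
          W1 = (\<chi> i k. cdet_sum s i (A ^^^ 2) (column k Uhat));
          V2 = (\<chi> t j. rdet_sum s j (A ^^^ 2) (row t Ghat));
          W2 = (\<chi> i k. cdet_sum s i (A ^^^ 2) (column k Ghat))
      in \<forall>i j. \<forall>(V, W) \<in> {(V1, W1), (V2, W2)}.
          X $ i $ j = cdet_sum s i (A ^^^ 2) (column j V) /
            of_real ((minor_sum s (A ^^^ 2))\<^sup>2 * minor_sum s\<^sub>1 (A ^^^ (m + 1))) \<and>
          X $ i $ j = rdet_sum s j (A ^^^ 2) (row i W) /
            of_real ((minor_sum s (A ^^^ 2))\<^sup>2 * minor_sum s\<^sub>1 (A ^^^ (m + 1)))))"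
proof -
  have Ind: "Ind A = m" by fact
  let ?B = "A ^^^ (2 * m + 1)" and ?p = "A ^^^ (m + 1)"
  have rk_p: "rk ?p = s\<^sub>1" and rk_B: "rk ?B = s\<^sub>1"
    using assms(3) rk_mpow_add_Ind[of A 1] rk_mpow_add_Ind[of A "m + 1"] Ind by (simp_all add: mult_2 add.assoc)
  \<comment> \<open>This makes \<open>s\<close> positive, so that \<open>minor_sum\<close> is
    meaningful at \<open>s\<close> too.\<close>
  have "s\<^sub>1 \<le> s"
    using rk_mult_le[of A "A ^^^ m"] rk_p assms(1) by simp
  then have s: "s \<ge> 1" using assms(4) by simp
  have X: "X = A\<^sup>\<dagger> ** A ** A\<^sup>d ** A ** A\<^sup>\<dagger>"
    unfolding assms(5) CMP_inverse_def by (simp add: matrix_mul_assoc)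
  have pA: "A ** A ^^^ m = ?p" "A ^^^ m ** A = ?p"
    using mpow_Suc_right[of A m] by simp_all
  show ?thesis
  proof (intro conjI impI, goal_cases)
    case 1
    define B where "B = A ^^^ (2 * m + 1)"
    have rk_B': "rk B = s\<^sub>1" using rk_B by (simp only: B_def)
    define c where "c = pminor_sum (A\<^sup>H ** A) s"
    define d where "d = pminor_sum (B\<^sup>H ** B) s\<^sub>1"
    have c: "minor_sum s (A\<^sup>H ** A) = c" "minor_sum s (A ** A\<^sup>H) = c" "c \<noteq> 0"
      and RA: "rdet_mat (A\<^sup>H ** A) s ** A\<^sup>H = c *\<^sub>R A\<^sup>\<dagger>" "A\<^sup>H ** rdet_mat (A ** A\<^sup>H) s = c *\<^sub>R A\<^sup>\<dagger>"
      using minor_sum_adj_mult[of A] minor_sum_mult_adj[of A] pminor_sum_adj_mult_rk[of A]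
        rdet_mat_adj_mult[of A] rdet_mat_mult_adj[of A] s
      unfolding assms(1) c_def by blast+
    have d: "minor_sum s\<^sub>1 (B\<^sup>H ** B) = d" "d \<noteq> 0"
      and RB: "rdet_mat (B\<^sup>H ** B) s\<^sub>1 ** B\<^sup>H = d *\<^sub>R B\<^sup>\<dagger>" "B\<^sup>H ** rdet_mat (B ** B\<^sup>H) s\<^sub>1 = d *\<^sub>R B\<^sup>\<dagger>"
      using minor_sum_adj_mult[of B] pminor_sum_adj_mult_rk[of B]
        rdet_mat_adj_mult[of B] rdet_mat_mult_adj[of B] assms(4)
      unfolding rk_B' d_def by blast+
    have X': "X = A\<^sup>\<dagger> ** (?p ** B\<^sup>\<dagger> ** ?p) ** A\<^sup>\<dagger>"
      unfolding X Drazin_inverse_eq_MP_inverse Ind B_def[symmetric] using pA by (metis matrix_mul_assoc)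
    \<comment> \<open>The outer factors \<open>A\<^sup>H\<close> turn each \<open>rdet_mat\<close>
      into a multiple of \<open>A\<^sup>\<dagger>\<close>.\<close>
    have "rdet_mat (A\<^sup>H ** A) s ** (A\<^sup>H ** (d *\<^sub>R (?p ** B\<^sup>\<dagger> ** ?p)) ** A\<^sup>H) ** rdet_mat (A ** A\<^sup>H) s =
        rdet_mat (A\<^sup>H ** A) s ** A\<^sup>H ** (d *\<^sub>R (?p ** B\<^sup>\<dagger> ** ?p)) ** (A\<^sup>H ** rdet_mat (A ** A\<^sup>H) s)"
      by (simp only: matrix_mul_assoc)
    also have "\<dots> = (c\<^sup>2 * d) *\<^sub>R X"
      unfolding RA X' by (simp only: matrix_scaleR_left matrix_scaleR_right scaleR_scaleR power2_eq_square mult_ac)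
    finally have sandwich: "rdet_mat (A\<^sup>H ** A) s ** (A\<^sup>H ** (d *\<^sub>R (?p ** B\<^sup>\<dagger> ** ?p)) ** A\<^sup>H) **
        rdet_mat (A ** A\<^sup>H) s = (c\<^sup>2 * d) *\<^sub>R X" .
    \<comment> \<open>\<open>Uhat\<close> and \<open>Ghat\<close> turn out to be the same matrix, so
      one identity serves both pairs \<open>(V1, W1)\<close> and \<open>(V2, W2)\<close>.\<close>
    have "A\<^sup>H ** ?p ** B\<^sup>H ** rdet_mat (B ** B\<^sup>H) s\<^sub>1 ** ?p ** A\<^sup>H =
        A\<^sup>H ** ?p ** (B\<^sup>H ** rdet_mat (B ** B\<^sup>H) s\<^sub>1) ** ?p ** A\<^sup>H"
      by (simp only: matrix_mul_assoc)
    then have U: "A\<^sup>H ** ?p ** B\<^sup>H ** rdet_mat (B ** B\<^sup>H) s\<^sub>1 ** ?p ** A\<^sup>H =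
        A\<^sup>H ** (d *\<^sub>R (?p ** B\<^sup>\<dagger> ** ?p)) ** A\<^sup>H"
      unfolding RB by (simp only: matrix_scaleR_left matrix_scaleR_right matrix_mul_assoc)
    have "A\<^sup>H ** ?p ** (rdet_mat (B\<^sup>H ** B) s\<^sub>1 ** (B\<^sup>H ** ?p ** A\<^sup>H)) =
        A\<^sup>H ** ?p ** (rdet_mat (B\<^sup>H ** B) s\<^sub>1 ** B\<^sup>H) ** ?p ** A\<^sup>H"
      by (simp only: matrix_mul_assoc)
    then have G: "A\<^sup>H ** ?p ** (rdet_mat (B\<^sup>H ** B) s\<^sub>1 ** (B\<^sup>H ** ?p ** A\<^sup>H)) =
        A\<^sup>H ** (d *\<^sub>R (?p ** B\<^sup>\<dagger> ** ?p)) ** A\<^sup>H"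
      unfolding RB by (simp only: matrix_scaleR_left matrix_scaleR_right matrix_mul_assoc)
    note rep = CMP_inverse_representation[OF hermitian_mult_adj(2) hermitian_mult_adj(1) sandwich c(1,2) d(1) c(3) d(2)]
    show ?case
      unfolding Let_def B_def[symmetric] rdet_sum_rows cdet_sum_columns[OF hermitian_mult_adj(2)] U G
      using rep by blast
  next
    case 2
    then have herm: "hermitian A" and AH: "A\<^sup>H = A" by (simp_all add: hermitian_def)
    let ?K = "A ^^^ 2"
    have K: "?K = A ** A" by (simp add: numeral_2_eq_2)
    have hK: "hermitian ?K" and hp: "hermitian ?p"
      using hermitian_mpow[OF herm] by blast+
    have rk_K: "rk ?K = s"
      using rk_mult_adj[of A] assms(1) by (simp add: K AH)
    define c where "c = pminor_sum ?K s"
    define d where "d = pminor_sum ?p s\<^sub>1"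
    have c: "minor_sum s ?K = c" "c \<noteq> 0"
      using minor_sum_eq_pminor_sum[OF hK s] pminor_sum_rk[OF hK] unfolding rk_K c_def by blast+
    have d: "minor_sum s\<^sub>1 ?p = d" "d \<noteq> 0"
      using minor_sum_eq_pminor_sum[OF hp assms(4)] pminor_sum_rk[OF hp] unfolding rk_p d_def by blast+
    have RK: "rdet_mat ?K s = c *\<^sub>R ginv ?K" and Rp: "rdet_mat ?p s\<^sub>1 = d *\<^sub>R ginv ?p"
      using rdet_mat_eq_ginv[OF hK] rdet_mat_eq_ginv[OF hp] unfolding rk_K rk_p c_def d_def by blast+
    let ?L = "A ^^^ (m + 2)"
    have L: "?L = A ** A ** A ^^^ m" "?L = A ^^^ m ** (A ** A)"
      using mpow_add[of A m 2] mpow_add[of A 2 m] unfolding K by (simp_all only: add.commute)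
    have MP: "A\<^sup>\<dagger> = ginv ?K ** A" "A\<^sup>\<dagger> = A ** ginv ?K"
      using MP_inverse_left[of A] MP_inverse_right[of A] by (simp_all only: AH K)
    have AG: "A ** ginv ?p = ginv ?p ** A"
      using Drazin_inverse_hermitian(2)[OF herm] unfolding Ind .
    have Gm: "ginv ?p ** A ^^^ m = A ^^^ m ** ginv ?p"
      by (rule mpow_commutes[OF AG[symmetric]])
    have X': "X = ginv ?K ** (?L ** ginv ?p ** ?K) ** ginv ?K"
    proof -
      \<comment> \<open>The two forms of \<open>A\<^sup>\<dagger>\<close> are used on opposite
        sides, so that \<open>ginv ?K\<close> ends up outermost.\<close>
      have "X = ginv ?K ** A ** A ** (A ^^^ m ** ginv ?p) ** A ** (A ** ginv ?K)"
        unfolding X Drazin_inverse_hermitian(1)[OF herm] Ind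
        by (rule arg_cong2[OF MP, of "\<lambda>P Q. P ** A ** (A ^^^ m ** ginv ?p) ** A ** Q"])
      then show ?thesis
        unfolding L(1) K by (simp only: matrix_mul_assoc)
    qed
    have sandwich: "rdet_mat ?K s ** (d *\<^sub>R (?L ** ginv ?p ** ?K)) ** rdet_mat ?K s = (c\<^sup>2 * d) *\<^sub>R X"
      unfolding X' RK by (simp add: matrix_mul_assoc power2_eq_square del: mpow.simps(2))
    have U: "?L ** rdet_mat ?p s\<^sub>1 ** ?K = d *\<^sub>R (?L ** ginv ?p ** ?K)"
      unfolding Rp by (simp only: matrix_scaleR_left matrix_scaleR_right)
    \<comment> \<open>Moving \<open>ginv ?p\<close> past \<open>A ^^^ m\<close> shows that
      \<open>Ghat\<close> equals \<open>Uhat\<close> here as well.\<close>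
    have "?K ** (ginv ?p ** ?L) = ?K ** (ginv ?p ** A ^^^ m) ** ?K"
      unfolding L(2) K by (simp only: matrix_mul_assoc)
    also have "\<dots> = ?L ** ginv ?p ** ?K"
      unfolding Gm L(1) K by (simp only: matrix_mul_assoc)
    finally have G: "?K ** (rdet_mat ?p s\<^sub>1 ** ?L) = d *\<^sub>R (?L ** ginv ?p ** ?K)"
      unfolding Rp by (simp only: matrix_scaleR_left matrix_scaleR_right)
    note rep = CMP_inverse_representation[OF hK hK sandwich c(1) c(1) d(1) c(2) d(2)]
    show ?case
      unfolding Let_def rdet_sum_rows cdet_sum_columns[OF hK] cdet_sum_columns[OF hp] U G
      using rep by blast
  qed
qed

end
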